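(* Let $m\ge 2$, let $\boldsymbol{\ell}=(l(1),\dots,l(m))$ be any type, put $L=\sum_{k=1}^m l(k)$, and let $\boldsymbol{\rho}\in\mathfrak{R}^{\boldsymbol{\ell}}_{\mathrm{small}}$ be any small contraction vector. Then the set $$E=\left\{(\mathfrak{b},\boldsymbol{\tau})\in\mathfrak{B}^{\boldsymbol{\ell}}\times\mathbb{R}^m:\ \mathcal{F}^{(\mathfrak{b},\boldsymbol{\tau},\boldsymbol{\rho})}\text{ is not regular}\right\}\subset\mathbb{R}^{L+m}$$ has packing dimension $\dim_{\rm P}E<L+m$.
   Context: Write $[n]=\{1,\dots,n\}$. A CPLIFS (continuous piecewise linear iterated function system) of type $\boldsymbol{\ell}=(l(1),\dots,l(m))$ (nonnegative integers) is a finite list $\mathcal{F}=\{f_k\}_{k=1}^m$, $m\ge2$, of continuous piecewise linear maps $f_k:\mathbb{R}\to\mathbb{R}$ (not necessarily injective), where $f_k$ has exactly $l(k)$ breaking points $b_{k,1}<\dots<b_{k,l(k)}$ (points where the slope changes) and on the $l(k)+1$ open intervals of linearity $J_{k,1}=(-\infty,b_{k,1})$, $J_{k,i}=(b_{k,i-1},b_{k,i})$ for $2\le i\le l(k)$, $J_{k,l(k)+1}=(b_{k,l(k)},\infty)$ it has constant slopes $\rho_{k,i}\in(-1,1)\setminus\{0\}$. Parameters: $L=\sum_k l(k)$; $\mathfrak{B}^{\boldsymbol{\ell}}\subset\mathbb{R}^L$ is the set of vectors $\mathfrak{b}=(b_{k,i})_{k\in[m],i\in[l(k)]}$ with $b_{k,1}<\dots<b_{k,l(k)}$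 for every $k$; $\boldsymbol{\tau}=(\tau_1,\dots,\tau_m)\in\mathbb{R}^m$; $\mathfrak{R}^{\boldsymbol{\ell}}$ is the set of vectors $\boldsymbol{\rho}=(\rho_{k,i})_{k\in[m],i\in[l(k)+1]}$ with entries in $(-1,1)\setminus\{0\}$ and $\rho_{k,i}\ne\rho_{k,i+1}$ for all $k$ and $i\in[l(k)]$. $\mathcal{F}^{(\mathfrak{b},\boldsymbol{\tau},\boldsymbol{\rho})}$ is the unique CPLIFS with breaking points $\mathfrak{b}$, slopes $f_k'|_{J_{k,i}}\equiv\rho_{k,i}$, and $f_k(0)=\tau_k$. Small: let $\rho_k=\max_{i\in[l(k)+1]}|\rho_{k,i}|$ and $\rho_{\max}=\max_k\rho_k$. $\mathcal{F}$ is small if (a) $\sum_{k=1}^m\rho_k<1$, and (b) for each $k$: if $f_k$ is injective then $\rho_k<\frac12$; if $f_k$ is not injective then $\rho_k<\frac{1-\rho_{\max}}{2}$. $\mathfrak{R}^{\boldsymbol{\ell}}_{\mathrm{small}}$ is the set of $\boldsymbol{\rho}\in\mathfrak{R}^{\boldsymbol{\ell}}$ such that $\mathcal{F}^{(\mathfrak{b},\boldsymbol{\tau},\boldsymbol{\rho})}$ is small for all $\mathfrak{b}\in\mathfrak{B}^{\boldsymbol{\ell}}$, $\boldsymbol{\tau}\in\mathbb{R}^m$. The attractor $\Lambda^{\mathcal{F}}$ is the unique nonempty compact set with $\Lambda^{\mathcal{F}}=\bigcup_k f_k(\Lambda^{\mathcal{F}})$. A small CPLIFS is regular if $\Lambda^{\mathcal{F}}$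 contains none of the breaking points $b_{k,i}$, $k\in[m]$, $i\in[l(k)]$. $\dim_{\rm P}$ denotes packing dimension. *)

theory Defs
  imports "HOL-Analysis.Analysis"
begin

section \<open>Packing dimension in a metric space\<close>

text \<open>
  A packing is a set of pairs (centre, radius). The balls are taken in the ambient space \<open>M\<close>,
  only the centres have to lie in \<open>A\<close>.
\<close>

definition is_packing ::
  "'a set \<Rightarrow> ('a \<Rightarrow> 'a \<Rightarrow> real) \<Rightarrow> 'a set \<Rightarrow> real \<Rightarrow> ('a \<times> real) set \<Rightarrow> bool" where
  "is_packing M d A \<delta> C \<longleftrightarrow>
     countable C \<and> (\<forall>(x, r)\<in>C. x \<in> A \<and> 0 < r \<and> r \<le> \<delta>) \<and>
     disjoint_family_on (\<lambda>(x, r). Metric_space.mcball M d x r) C"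

definition packing_premeasure_scale ::
  "'a set \<Rightarrow> ('a \<Rightarrow> 'a \<Rightarrow> real) \<Rightarrow> real \<Rightarrow> real \<Rightarrow> 'a set \<Rightarrow> ennreal" where
  "packing_premeasure_scale M d s \<delta> A =
     (SUP C\<in>{C. is_packing M d A \<delta> C}. \<Sum>\<^sub>\<infinity>(x, r)\<in>C. ennreal ((2 * r) powr s))"

definition packing_premeasure ::
  "'a set \<Rightarrow> ('a \<Rightarrow> 'a \<Rightarrow> real) \<Rightarrow> real \<Rightarrow> 'a set \<Rightarrow> ennreal" where
  "packing_premeasure M d s A = (INF \<delta>\<in>{0<..}. packing_premeasure_scale M d s \<delta> A)"

definition packing_measure ::
  "'a set \<Rightarrow> ('a \<Rightarrow> 'a \<Rightarrow> real) \<Rightarrow> real \<Rightarrow> 'a set \<Rightarrow> ennreal" where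
  "packing_measure M d s E =
     (INF A\<in>{A :: nat \<Rightarrow> 'a set. (\<forall>n. A n \<subseteq> M) \<and> E \<subseteq> (\<Union>n. A n)}.
        \<Sum>n. packing_premeasure M d s (A n))"

definition packing_dim :: "'a set \<Rightarrow> ('a \<Rightarrow> 'a \<Rightarrow> real) \<Rightarrow> 'a set \<Rightarrow> ereal" where
  "packing_dim M d E = Inf {ereal s | s. 0 \<le> s \<and> packing_measure M d s E = 0}"

section \<open>Euclidean spaces with an arbitrary finite index set\<close>

text \<open>
  The dimension depends on the type of the system, so \<open>\<real>\<^sup>I\<close> is represented by the extensional
  functions on \<open>I\<close>.
\<close>

definition euclid_space :: "'i set \<Rightarrow> ('i \<Rightarrow> real) set" where
  "euclid_space I = (I \<rightarrow>\<^sub>E UNIV)"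

definition euclid_dist :: "'i set \<Rightarrow> ('i \<Rightarrow> real) \<Rightarrow> ('i \<Rightarrow> real) \<Rightarrow> real" where
  "euclid_dist I x y = L2_set (\<lambda>i. x i - y i) I"

lemma Metric_space_euclid:
  assumes "finite I"
  shows "Metric_space (euclid_space I) (euclid_dist I)"
proof
  fix x y z :: "'a \<Rightarrow> real"
  show "0 \<le> euclid_dist I x y" by (simp add: euclid_dist_def)
  show "euclid_dist I x y = euclid_dist I y x"
    by (simp add: euclid_dist_def L2_set_def power2_commute)
  show "(euclid_dist I x y = 0) = (x = y)" if "x \<in> euclid_space I" "y \<in> euclid_space I"
    using that assms by (auto simp: euclid_dist_def euclid_space_def L2_set_eq_0_iff intro: PiE_ext)
  show "euclid_dist I x z \<le> euclid_dist I x y + euclid_dist I y z"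
    using L2_set_triangle_ineq[of "\<lambda>i. x i - y i" "\<lambda>i. y i - z i" I]
    by (simp add: euclid_dist_def)
qed

section \<open>Continuous piecewise linear iterated function systems\<close>

definition break_idx :: "nat \<Rightarrow> (nat \<Rightarrow> nat) \<Rightarrow> (nat \<times> nat) set" where
  "break_idx m l = (SIGMA k:{1..m}. {1..l k})"

definition slope_idx :: "nat \<Rightarrow> (nat \<Rightarrow> nat) \<Rightarrow> (nat \<times> nat) set" where
  "slope_idx m l = (SIGMA k:{1..m}. {1..l k + 1})"

definition break_vectors :: "nat \<Rightarrow> (nat \<Rightarrow> nat) \<Rightarrow> (nat \<times> nat \<Rightarrow> real) set" where
  "break_vectors m l =
     {b \<in> euclid_space (break_idx m l).
        \<forall>k\<in>{1..m}. strict_mono_on {1..l k} (\<lambda>i. b (k, i))}"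

definition translation_vectors :: "nat \<Rightarrow> (nat \<Rightarrow> real) set" where
  "translation_vectors m = euclid_space {1..m}"

definition slope_vectors :: "nat \<Rightarrow> (nat \<Rightarrow> nat) \<Rightarrow> (nat \<times> nat \<Rightarrow> real) set" where
  "slope_vectors m l =
     {\<rho> \<in> slope_idx m l \<rightarrow>\<^sub>E ({-1<..<1} - {0}).
        \<forall>k\<in>{1..m}. \<forall>i\<in>{1..l k}. \<rho> (k, i) \<noteq> \<rho> (k, i + 1)}"

text \<open>
  The \<open>i\<close>-th interval of linearity, for \<open>1 \<le> i \<le> n + 1\<close>, of a map with breaking points
  \<open>\<beta> 1 < \<dots> < \<beta> n\<close>: the lower bound is absent for \<open>i = 1\<close> and the upper one for \<open>i = n + 1\<close>.
\<close>

definition lin_interval :: "nat \<Rightarrow> (nat \<Rightarrow> real) \<Rightarrow> nat \<Rightarrow> real set" where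
  "lin_interval n \<beta> i = {x. (1 < i \<longrightarrow> \<beta> (i - 1) < x) \<and> (i \<le> n \<longrightarrow> x < \<beta> i)}"

definition is_cpl_map ::
  "nat \<Rightarrow> (nat \<Rightarrow> real) \<Rightarrow> (nat \<Rightarrow> real) \<Rightarrow> real \<Rightarrow> (real \<Rightarrow> real) \<Rightarrow> bool" where
  "is_cpl_map n \<beta> \<sigma> t f \<longleftrightarrow>
     continuous_on UNIV f \<and> f 0 = t \<and>
     (\<forall>i\<in>{1..n + 1}. \<forall>x\<in>lin_interval n \<beta> i. (f has_real_derivative \<sigma> i) (at x))"

lemma cpl_map_exists:
  assumes mono: "strict_mono_on {1..n} \<beta>"
  shows "\<exists>f. is_cpl_map n \<beta> \<sigma> t f"
proof -
  define g where "g x = \<sigma> 1 * x + (\<Sum>i=1..n. (\<sigma> (i + 1) - \<sigma> i) * max 0 (x - \<beta> i))" for x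
  have le: "\<beta> i \<le> \<beta> j" if "1 \<le> i" "i \<le> j" "j \<le> n" for i j
    using strict_mono_onD[OF mono, of i j] that by (cases "i = j") auto
  have "(g has_real_derivative \<sigma> j) (at x)"
    if j: "j \<in> {1..n + 1}" and x: "x \<in> lin_interval n \<beta> j" for j x
  proof -
    have tele: "(\<Sum>i=1..<j. \<sigma> (i + 1) - \<sigma> i) = \<sigma> j - \<sigma> 1"
      using sum_Suc_diff'[of 1 j \<sigma>] j by simp
    have der: "((\<lambda>x. (\<sigma> (i + 1) - \<sigma> i) * max 0 (x - \<beta> i)) has_real_derivative
        (if i < j then \<sigma> (i + 1) - \<sigma> i else 0)) (at x)" if i: "i \<in> {1..n}" for i
    proof (cases "i < j")
      case True
      then have "\<beta> i \<le> \<beta> (j - 1)" using i j by (intro le) auto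
      then have "\<beta> i < x" using x True i by (auto simp: lin_interval_def)
      then have ev: "\<forall>\<^sub>F y in nhds x. (\<sigma> (i + 1) - \<sigma> i) * max 0 (y - \<beta> i) = (\<sigma> (i + 1) - \<sigma> i) * (y - \<beta> i)"
        by (intro eventually_mono[OF eventually_nhds_in_open[of "{\<beta> i<..}" x]]) auto
      show ?thesis
        by (subst DERIV_cong_ev[OF refl ev refl])
           (use True in \<open>auto intro!: derivative_eq_intros\<close>)
    next
      case False
      then have "\<beta> j \<le> \<beta> i" using i j by (intro le) auto
      then have "x < \<beta> i" using x False i by (auto simp: lin_interval_def)
      then have ev: "\<forall>\<^sub>F y in nhds x. (\<sigma> (i + 1) - \<sigma> i) * max 0 (y - \<beta> i) = 0"
        by (intro eventually_mono[OF eventually_nhds_in_open[of "{..<\<beta> i}" x]]) auto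
      show ?thesis
        by (subst DERIV_cong_ev[OF refl ev refl]) (use False in auto)
    qed
    have "(g has_real_derivative \<sigma> 1 + (\<Sum>i=1..n. if i < j then \<sigma> (i + 1) - \<sigma> i else 0)) (at x)"
      unfolding g_def by (intro DERIV_add DERIV_sum der) (auto intro!: derivative_eq_intros)
    moreover have "(\<Sum>i=1..n. if i < j then \<sigma> (i + 1) - \<sigma> i else 0) = (\<Sum>i=1..<j. \<sigma> (i + 1) - \<sigma> i)"
      by (rule sum.mono_neutral_cong_right) (use j in auto)
    ultimately show ?thesis using tele by simp
  qed
  moreover have "continuous_on UNIV g"
    unfolding g_def by (intro continuous_intros)
  ultimately have "is_cpl_map n \<beta> \<sigma> t (\<lambda>x. g x - g 0 + t)"
    unfolding is_cpl_map_def
    by (auto intro!: continuous_intros derivative_eq_intros)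
  then show ?thesis by blast
qed

lemma cpl_map_unique:
  assumes f: "is_cpl_map n \<beta> \<sigma> t f" and g: "is_cpl_map n \<beta> \<sigma> t g"
  shows "f = g"
proof
  fix x
  define h where "h y = f y - g y" for y
  have d: "(h has_real_derivative 0) (at y)" if y: "y \<notin> \<beta> ` {1..n}" for y
  proof -
    define i where "i = (LEAST i. i = n + 1 \<or> (1 \<le> i \<and> i \<le> n \<and> y < \<beta> i))"
    have i: "i = n + 1 \<or> (1 \<le> i \<and> i \<le> n \<and> y < \<beta> i)"
      unfolding i_def by (rule LeastI[of _ "n + 1"]) simp
    have "\<beta> (i - 1) < y" if "1 < i"
    proof (rule ccontr)
      assume "\<not> \<beta> (i - 1) < y"
      moreover have "i - 1 \<in> {1..n}" using i that by auto
      then have "\<beta> (i - 1) \<noteq> y" using y by blast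
      ultimately have "i \<le> i - 1"
        using i that by (subst i_def, intro Least_le) auto
      then show False using that by simp
    qed
    then have "y \<in> lin_interval n \<beta> i" "i \<in> {1..n + 1}"
      using i by (auto simp: lin_interval_def)
    then have "(f has_real_derivative \<sigma> i) (at y)" "(g has_real_derivative \<sigma> i) (at y)"
      using f g by (auto simp: is_cpl_map_def)
    from DERIV_diff[OF this] show ?thesis unfolding h_def by simp
  qed
  have "h x = h 0"
  proof (rule has_derivative_zero_unique_strong_convex[of UNIV "\<beta> ` {1..n}" h 0 "h 0" x])
    show "continuous_on UNIV h"
      using f g unfolding h_def is_cpl_map_def by (auto intro!: continuous_intros)
    show "(h has_derivative (\<lambda>_. 0)) (at y within UNIV)" if "y \<in> UNIV - \<beta> ` {1..n}" for y
      using d[of y] that by (simp add: has_field_derivative_def lambda_zero)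
  qed auto
  also have "h 0 = 0" using f g by (simp add: h_def is_cpl_map_def)
  finally show "f x = g x" by (simp add: h_def)
qed

definition cpl_map :: "nat \<Rightarrow> (nat \<Rightarrow> real) \<Rightarrow> (nat \<Rightarrow> real) \<Rightarrow> real \<Rightarrow> real \<Rightarrow> real" where
  "cpl_map n \<beta> \<sigma> t = (THE f. is_cpl_map n \<beta> \<sigma> t f)"

lemma is_cpl_map_cpl_map:
  "strict_mono_on {1..n} \<beta> \<Longrightarrow> is_cpl_map n \<beta> \<sigma> t (cpl_map n \<beta> \<sigma> t)"
  unfolding cpl_map_def using cpl_map_exists cpl_map_unique by (metis theI)

text \<open>Only the maps with index \<open>k \<in> {1..m}\<close> belong to the system.\<close>

definition cplifs ::
  "(nat \<Rightarrow> nat) \<Rightarrow> (nat \<times> nat \<Rightarrow> real) \<Rightarrow> (nat \<Rightarrow> real) \<Rightarrow> (nat \<times> nat \<Rightarrow> real) \<Rightarrow> nat \<Rightarrow> real \<Rightarrow> real"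
  where
  "cplifs l b \<tau> \<rho> k = cpl_map (l k) (\<lambda>i. b (k, i)) (\<lambda>i. \<rho> (k, i)) (\<tau> k)"

definition max_slope :: "(nat \<Rightarrow> nat) \<Rightarrow> (nat \<times> nat \<Rightarrow> real) \<Rightarrow> nat \<Rightarrow> real" where
  "max_slope l \<rho> k = (MAX i\<in>{1..l k + 1}. \<bar>\<rho> (k, i)\<bar>)"

definition rho_max :: "nat \<Rightarrow> (nat \<Rightarrow> nat) \<Rightarrow> (nat \<times> nat \<Rightarrow> real) \<Rightarrow> real" where
  "rho_max m l \<rho> = (MAX k\<in>{1..m}. max_slope l \<rho> k)"

definition small_cplifs ::
  "nat \<Rightarrow> (nat \<Rightarrow> nat) \<Rightarrow> (nat \<times> nat \<Rightarrow> real) \<Rightarrow> (nat \<Rightarrow> real) \<Rightarrow> (nat \<times> nat \<Rightarrow> real) \<Rightarrow> bool"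
  where
  "small_cplifs m l b \<tau> \<rho> \<longleftrightarrow>
     (\<Sum>k=1..m. max_slope l \<rho> k) < 1 \<and>
     (\<forall>k\<in>{1..m}.
        (inj (cplifs l b \<tau> \<rho> k) \<longrightarrow> max_slope l \<rho> k < 1 / 2) \<and>
        (\<not> inj (cplifs l b \<tau> \<rho> k) \<longrightarrow> max_slope l \<rho> k < (1 - rho_max m l \<rho>) / 2))"

definition small_slope_vectors :: "nat \<Rightarrow> (nat \<Rightarrow> nat) \<Rightarrow> (nat \<times> nat \<Rightarrow> real) set" where
  "small_slope_vectors m l =
     {\<rho> \<in> slope_vectors m l.
        \<forall>b\<in>break_vectors m l. \<forall>\<tau>\<in>translation_vectors m. small_cplifs m l b \<tau> \<rho>}"

definition attractor :: "nat \<Rightarrow> (nat \<Rightarrow> real \<Rightarrow> real) \<Rightarrow> real set" where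
  "attractor m F = (THE \<Lambda>. \<Lambda> \<noteq> {} \<and> compact \<Lambda> \<and> \<Lambda> = (\<Union>k\<in>{1..m}. F k ` \<Lambda>))"

definition regular_cplifs ::
  "nat \<Rightarrow> (nat \<Rightarrow> nat) \<Rightarrow> (nat \<times> nat \<Rightarrow> real) \<Rightarrow> (nat \<Rightarrow> real) \<Rightarrow> (nat \<times> nat \<Rightarrow> real) \<Rightarrow> bool"
  where
  "regular_cplifs m l b \<tau> \<rho> \<longleftrightarrow>
     (\<forall>(k, i)\<in>break_idx m l. b (k, i) \<notin> attractor m (cplifs l b \<tau> \<rho>))"

section \<open>The parameter space\<close>

definition param_space :: "nat \<Rightarrow> (nat \<Rightarrow> nat) \<Rightarrow> ((nat \<times> nat \<Rightarrow> real) \<times> (nat \<Rightarrow> real)) set" where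
  "param_space m l = euclid_space (break_idx m l) \<times> euclid_space {1..m}"

definition param_dist ::
  "nat \<Rightarrow> (nat \<Rightarrow> nat) \<Rightarrow> (nat \<times> nat \<Rightarrow> real) \<times> (nat \<Rightarrow> real) \<Rightarrow>
     (nat \<times> nat \<Rightarrow> real) \<times> (nat \<Rightarrow> real) \<Rightarrow> real" where
  "param_dist m l = prod_dist (euclid_dist (break_idx m l)) (euclid_dist {1..m})"

text \<open>
  Together with the cardinality of the index sets this says that the parameter space is a copy of
  \<open>\<real>\<^bsup>L + m\<^esup>\<close> with the Euclidean metric.
\<close>

lemma card_break_idx: "card (break_idx m l) = (\<Sum>k=1..m. l k)"
  by (simp add: break_idx_def)

lemma Metric_space_param: "Metric_space (param_space m l) (param_dist m l)"
  unfolding param_space_def param_dist_def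
  by (intro Metric_space12.prod_metric Metric_space12.intro Metric_space_euclid)
     (auto simp: break_idx_def)

end

theory Submission
  imports Defs
begin

text \<open>
  If a breaking point lies in the attractor, it equals \<open>f\<^bsub>w\<^esub>(x)\<close> for a word \<open>w\<close> of any prescribed
  length \<open>n\<close> and a point \<open>x\<close> of the attractor. Smallness forces all contraction rates to be below
  \<open>1/2\<close>, so for fixed \<open>w = k v\<close> the point \<open>f\<^bsub>w\<^esub>(x)\<close> moves with speed bounded below as \<open>\<tau>\<^sub>k\<close> varies,
  while it depends in a Lipschitz way on the remaining parameters. Hence the parameters for which
  \<open>w\<close> occurs form a tube of thickness about \<open>\<rho>\<^bsub>w\<^esub>\<close> around a Lipschitz graph over \<open>N - 1\<close>
  coordinates, \<open>N = L + m\<close>, and this tube contains at most a constant times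
  \<open>u\<^bsup>-N\<^esup> (\<rho>\<^bsub>w\<^esub> + u)\<close> points that are \<open>u\<close>-separated.
  Summation over all words of length \<open>n\<close> gives \<open>u\<^bsup>-N\<^esup> (\<kappa>\<^sup>n + m\<^sup>n u)\<close> with \<open>\<kappa> = \<rho>\<^sub>1 + \<dots> + \<rho>\<^sub>m < 1\<close>.
  With \<open>u\<close> comparable to \<open>m\<^bsup>-2n\<^esup>\<close> this beats \<open>u\<^bsup>-N\<^esup>\<close> by a power of \<open>u\<close>.
\<close>

section \<open>Attractors of finite systems of contractions\<close>

text \<open>Take \<open>a\<close> in \<open>A\<close> at maximal distance from \<open>B\<close>. It
  is the image of some \<open>a'\<close> in \<open>A\<close>, and the image of a point of
  \<open>B\<close> nearest to \<open>a'\<close> lies in \<open>B\<close>, so the maximal distance is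
  at most \<open>r\<close> times itself and vanishes. For two invariant compact sets this gives
  uniqueness; for a ball it bounds the attractor.\<close>

lemma contraction_attractor_subset:
  fixes F :: "'k \<Rightarrow> 'a::heine_borel \<Rightarrow> 'a"
  assumes r: "0 \<le> r" "r < 1"
    and contr: "\<And>k x y. k \<in> K \<Longrightarrow> dist (F k x) (F k y) \<le> r * dist x y"
    and A: "compact A" "A \<subseteq> (\<Union>k\<in>K. F k ` A)"
    and B: "closed B" "B \<noteq> {}" "(\<Union>k\<in>K. F k ` B) \<subseteq> B"
  shows "A \<subseteq> B"
proof (cases "A = {}")
  case False
  moreover have "continuous_on A (\<lambda>x. infdist x B)" by (intro continuous_intros)
  ultimately obtain a where a: "a \<in> A" "\<And>x. x \<in> A \<Longrightarrow> infdist x B \<le> infdist a B"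
    using continuous_attains_sup[OF A(1)] by blast
  then obtain k a' where k: "k \<in> K" "a' \<in> A" "a = F k a'" using A by blast
  obtain b where b: "b \<in> B" "infdist a' B = dist a' b"
    using infdist_attains_inf B by metis
  have "F k b \<in> B" using b k B by blast
  then have "infdist a B \<le> dist a (F k b)" by (rule infdist_le)
  also have "\<dots> \<le> r * infdist a' B" using contr k b by metis
  also have "\<dots> \<le> r * infdist a B" using a k r by (intro mult_left_mono) auto
  finally have "(1 - r) * infdist a B \<le> 0" by (simp add: algebra_simps)
  then have "infdist a B \<le> 0" using r by (simp add: mult_le_0_iff)
  show ?thesis
  proof
    fix x assume "x \<in> A"
    then have "infdist x B = 0" using a \<open>infdist a B \<le> 0\<close> infdist_nonneg by (metis order.antisym order.trans)
    then show "x \<in> B" using B in_closed_iff_infdist_zero by metis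
  qed
qed auto

text \<open>The radius \<open>R / (1 - r)\<close> is the fixed point of
  \<open>s \<mapsto> R + r * s\<close>.\<close>

lemma contractions_cball_invariant:
  fixes F :: "'k \<Rightarrow> 'a::metric_space \<Rightarrow> 'a"
  assumes r: "0 \<le> r" "r < 1"
    and contr: "\<And>k x y. k \<in> K \<Longrightarrow> dist (F k x) (F k y) \<le> r * dist x y"
    and R: "\<And>k. k \<in> K \<Longrightarrow> dist z (F k z) \<le> R"
  shows "(\<Union>k\<in>K. F k ` cball z (R / (1 - r))) \<subseteq> cball z (R / (1 - r))"
proof clarify
  fix k x assume k: "k \<in> K" and x: "x \<in> cball z (R / (1 - r))"
  have "dist z (F k x) \<le> dist z (F k z) + dist (F k z) (F k x)" by (rule dist_triangle)
  also have "\<dots> \<le> R + r * dist z x" using R contr k by (intro add_mono) auto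
  also have "\<dots> \<le> R + r * (R / (1 - r))"
    using x r by (intro add_left_mono mult_left_mono) auto
  also have "\<dots> = R / (1 - r)" using r by (simp add: field_simps)
  finally show "F k x \<in> cball z (R / (1 - r))" by simp
qed

text \<open>The iterates of the Hutchinson operator \<open>H\<close> on an invariant ball are nested
  nonempty compact sets; their intersection is the invariant set.\<close>

lemma contraction_attractor_exists:
  fixes F :: "'k \<Rightarrow> 'a::heine_borel \<Rightarrow> 'a"
  assumes r: "0 \<le> r" "r < 1"
    and contr: "\<And>k x y. k \<in> K \<Longrightarrow> dist (F k x) (F k y) \<le> r * dist x y"
    and K: "finite K" "K \<noteq> {}"
  shows "\<exists>A. A \<noteq> {} \<and> compact A \<and> A = (\<Union>k\<in>K. F k ` A)"
proof -
  fix z :: 'a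
  define R where "R = (\<Sum>k\<in>K. dist z (F k z))"
  define B where "B = cball z (R / (1 - r))"
  define H where "H A = (\<Union>k\<in>K. F k ` A)" for A
  define X where "X n = (H ^^ n) B" for n
  have R: "dist z (F k z) \<le> R" if "k \<in> K" for k
    unfolding R_def using K that by (intro member_le_sum) auto
  have "0 \<le> R" unfolding R_def by (intro sum_nonneg) auto
  have cont: "continuous_on S (F k)" if "k \<in> K" for k S
    by (rule continuous_on_subset[OF lipschitz_on_continuous_on[of r UNIV]])
       (use that r contr in \<open>auto simp: lipschitz_on_def\<close>)
  have mono: "H S \<subseteq> H T" if "S \<subseteq> T" for S T unfolding H_def using that by blast
  have XS: "X (Suc n) = H (X n)" for n by (simp add: X_def)
  have cX: "compact (X n)" for n
  proof (induction n)
    case (Suc n)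
    then show ?case unfolding XS H_def
      using K cont by (intro compact_UN compact_continuous_image) auto
  qed (auto simp: X_def B_def)
  have nX: "X n \<noteq> {}" for n
  proof (induction n)
    case 0
    have "0 \<le> R / (1 - r)" using \<open>0 \<le> R\<close> r by simp
    then show ?case by (auto simp: X_def B_def simp del: zero_le_divide_iff)
  next
    case (Suc n)
    then show ?case unfolding XS H_def using K by auto
  qed
  have step: "X (Suc n) \<subseteq> X n" for n
  proof (induction n)
    case 0
    then show ?case unfolding XS H_def using contractions_cball_invariant[OF r contr R]
      by (simp add: X_def B_def)
  next
    case (Suc n)
    then show ?case using mono XS by metis
  qed
  then have dec: "X n \<subseteq> X j" if "j \<le> n" for n j
    using that by (metis lift_Suc_antimono_le)
  define A where "A = (\<Inter>n. X n)"
  have "A \<noteq> {}" unfolding A_def using compact_nest[of X] cX nX dec by blast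
  moreover have "compact A" unfolding A_def using cX by (intro compact_Inter) auto
  moreover have "A = (\<Union>k\<in>K. F k ` A)"
  proof
    have "H A \<subseteq> X n" for n
    proof -
      have "H A \<subseteq> X (Suc n)" unfolding XS by (rule mono) (auto simp: A_def)
      then show ?thesis using step by blast
    qed
    then show "(\<Union>k\<in>K. F k ` A) \<subseteq> A" unfolding A_def H_def by blast
  next
    show "A \<subseteq> (\<Union>k\<in>K. F k ` A)"
    proof
      fix y assume y: "y \<in> A"
      \<comment> \<open>In general the image of an intersection is smaller than the intersection of
        the images. Compactness repairs this: the sets of preimages of \<open>y\<close> in
        \<open>X n\<close>, taken under all maps at once, decrease, so a single \<open>x\<close>
        serves every \<open>n\<close>; the letter \<open>k\<close> is then read off at
        \<open>n = 0\<close>.\<close>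
      define Y where "Y n = (\<Union>k\<in>K. {x \<in> X n. F k x = y})" for n
      have "compact (Y n)" for n unfolding Y_def
      proof (intro compact_UN K)
        fix k assume "k \<in> K"
        then have "closed (X n \<inter> F k -` {y})"
          using cont by (intro continuous_closed_preimage) (auto simp: compact_imp_closed cX)
        then have "compact (X n \<inter> (X n \<inter> F k -` {y}))" using cX by (intro compact_Int_closed)
        also have "X n \<inter> (X n \<inter> F k -` {y}) = {x \<in> X n. F k x = y}" by auto
        finally show "compact {x \<in> X n. F k x = y}" .
      qed
      moreover have "Y n \<noteq> {}" for n
      proof -
        have "y \<in> H (X n)" using y XS[of n] by (auto simp: A_def)
        then show ?thesis unfolding Y_def H_def by blast
      qed
      moreover have "Y n \<subseteq> Y j" if "j \<le> n" for n j using dec[OF that] by (auto simp: Y_def)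
      ultimately have "(\<Inter>n. Y n) \<noteq> {}" by (rule compact_nest)
      then obtain x where x: "x \<in> Y n" for n by blast
      have "x \<in> X n" for n using x[of n] by (auto simp: Y_def)
      moreover obtain k where "k \<in> K" "F k x = y" using x[of 0] by (auto simp: Y_def)
      ultimately show "y \<in> (\<Union>k\<in>K. F k ` A)" by (auto simp: A_def)
    qed
  qed
  ultimately show ?thesis by blast
qed

text \<open>Existence and uniqueness make the \<open>THE\<close> in \<open>attractor\<close> denote
  the invariant set; the bound comes from comparison with an invariant ball around 0.\<close>

lemma attractor_props:
  fixes F :: "nat \<Rightarrow> real \<Rightarrow> real"
  assumes r: "0 \<le> r" "r < 1" and m: "0 < m"
    and contr: "\<And>k x y. k \<in> {1..m} \<Longrightarrow> \<bar>F k x - F k y\<bar> \<le> r * \<bar>x - y\<bar>"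
  shows "attractor m F = (\<Union>k\<in>{1..m}. F k ` attractor m F)"
    and "\<lbrakk>\<And>k. k \<in> {1..m} \<Longrightarrow> \<bar>F k 0\<bar> \<le> R; x \<in> attractor m F\<rbrakk> \<Longrightarrow> \<bar>x\<bar> \<le> R / (1 - r)"
proof -
  let ?inv = "\<lambda>A. A = (\<Union>k\<in>{1..m}. F k ` A)"
  let ?P = "\<lambda>A. A \<noteq> {} \<and> compact A \<and> ?inv A"
  have contr': "dist (F k x) (F k y) \<le> r * dist x y" if "k \<in> {1..m}" for k x y
    using contr[OF that] by (simp add: dist_real_def)
  have ex: "\<exists>A. ?P A"
    by (rule contraction_attractor_exists[OF r contr']) (use m in auto)
  have sub: "S \<subseteq> T" if S: "?P S" and T: "?P T" for S T
  proof (rule contraction_attractor_subset[OF r contr'])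
    show "S \<subseteq> (\<Union>k\<in>{1..m}. F k ` S)" "(\<Union>k\<in>{1..m}. F k ` T) \<subseteq> T"
      using S T by (blast dest: equalityD1 equalityD2)+
    show "compact S" "T \<noteq> {}" using S T by blast+
    show "closed T" using T compact_imp_closed by blast
  qed
  have P: "?P (attractor m F)" unfolding attractor_def
  proof (rule theI'[of ?P])
    show "\<exists>!A. ?P A" using ex sub subset_antisym by (rule_tac ex_ex1I) blast+
  qed
  then have inv: "?inv (attractor m F)" and c: "compact (attractor m F)" by blast+
  show "attractor m F = (\<Union>k\<in>{1..m}. F k ` attractor m F)" by (rule inv)
  show "\<bar>x\<bar> \<le> R / (1 - r)" if F0: "\<And>k. k \<in> {1..m} \<Longrightarrow> \<bar>F k 0\<bar> \<le> R" and "x \<in> attractor m F"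
  proof -
    have "0 \<le> R" using F0[of 1] m by force
    then have "0 \<le> R / (1 - r)" using r by simp
    then have "cball 0 (R / (1 - r)) \<noteq> {}" by (simp del: zero_le_divide_iff)
    moreover have "(\<Union>k\<in>{1..m}. F k ` cball 0 (R / (1 - r))) \<subseteq> cball 0 (R / (1 - r))"
      by (rule contractions_cball_invariant[OF r contr']) (use F0 in \<open>auto simp: dist_real_def\<close>)
    ultimately have "attractor m F \<subseteq> cball 0 (R / (1 - r))"
      using contraction_attractor_subset[OF r contr' c equalityD1[OF inv]] by blast
    then show ?thesis using that by auto
  qed
qed

section \<open>Coding by words and dependence of coded points on the maps\<close>

lemma invariant_set_coding:
  assumes "A \<subseteq> (\<Union>k\<in>K. F k ` A)" and "y \<in> A"
  shows "\<exists>w x. length w = n \<and> set w \<subseteq> K \<and> x \<in> A \<and> y = foldr F w x"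
  using assms(2)
proof (induction n arbitrary: y)
  case (Suc n)
  have "y \<in> (\<Union>k\<in>K. F k ` A)" using assms(1) Suc.prems by (rule subsetD)
  then obtain k y' where k: "k \<in> K" "y' \<in> A" "y = F k y'" by blast
  from Suc.IH[OF k(2)] obtain w x where
    "length w = n" "set w \<subseteq> K" "x \<in> A" "y' = foldr F w x" by blast
  then have "length (k # w) = Suc n \<and> set (k # w) \<subseteq> K \<and> x \<in> A \<and> y = foldr F (k # w) x"
    using k by simp
  then show ?case by blast
qed simp

text \<open>Each letter adds an error \<open>e\<close> and contracts the earlier errors by at most
  \<open>r\<close>, which gives a geometric series. The gap between the starting points shrinks by
  the product of the individual rates, the quantity that is later summed over words.\<close>

lemma foldr_perturbation:
  fixes F F' :: "'k \<Rightarrow> real \<Rightarrow> real"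
  assumes r: "r < 1" and \<rho>: "\<And>i. i \<in> K \<Longrightarrow> 0 \<le> \<rho> i \<and> \<rho> i \<le> r"
    and lip: "\<And>i x y. i \<in> K \<Longrightarrow> \<bar>F' i x - F' i y\<bar> \<le> \<rho> i * \<bar>x - y\<bar>"
    and close: "\<And>i x. i \<in> K \<Longrightarrow> \<bar>F i x - F' i x\<bar> \<le> e"
    and e: "0 \<le> e" and w: "set w \<subseteq> K"
  shows "\<bar>foldr F w x - foldr F' w x'\<bar> \<le> e / (1 - r) + prod_list (map \<rho> w) * \<bar>x - x'\<bar>"
  using w
proof (induction w)
  case Nil
  then show ?case using e r by simp
next
  case (Cons k w)
  then have k: "k \<in> K" by simp
  let ?y = "foldr F w x" and ?y' = "foldr F' w x'"
  have "\<bar>F k ?y - F' k ?y'\<bar> \<le> e + \<rho> k * \<bar>?y - ?y'\<bar>"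
    using close[OF k, of ?y] lip[OF k, of ?y ?y'] by linarith
  also have "\<dots> \<le> e + \<rho> k * (e / (1 - r) + prod_list (map \<rho> w) * \<bar>x - x'\<bar>)"
    using Cons \<rho>[OF k] by (intro add_left_mono mult_left_mono) auto
  also have "\<dots> = e + \<rho> k * (e / (1 - r)) + prod_list (map \<rho> (k # w)) * \<bar>x - x'\<bar>"
    by (simp add: algebra_simps)
  also have "\<dots> \<le> e + r * (e / (1 - r)) + prod_list (map \<rho> (k # w)) * \<bar>x - x'\<bar>"
    using \<rho>[OF k] e r by (intro add_mono mult_right_mono) auto
  also have "e + r * (e / (1 - r)) = e / (1 - r)" using r by (simp add: field_simps)
  finally show ?case by simp
qed

text \<open>The translation \<open>\<tau> k\<close> enters the point coded by \<open>k # v\<close> directly with weight \<open>1\<close>, and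
  through the later occurrences of \<open>k\<close> with total weight at most \<open>r / (1 - r) < 1\<close>; hence the
  hypothesis \<open>r < 1 / 2\<close>.\<close>
lemma translation_transversality:
  fixes F F' :: "'k \<Rightarrow> real \<Rightarrow> real"
  assumes r: "r < 1 / 2" and \<rho>: "\<And>i. i \<in> K \<Longrightarrow> 0 \<le> \<rho> i \<and> \<rho> i \<le> r"
    and lip: "\<And>i x y. i \<in> K \<Longrightarrow> \<bar>F' i x - F' i y\<bar> \<le> \<rho> i * \<bar>x - y\<bar>"
    and close: "\<And>i x. i \<in> K \<Longrightarrow> \<bar>(F i x - \<tau> i) - (F' i x - \<tau>' i)\<bar> \<le> e"
    and \<tau>: "\<And>i. i \<in> K - {k} \<Longrightarrow> \<bar>\<tau> i - \<tau>' i\<bar> \<le> e"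
    and w: "set (k # v) \<subseteq> K"
    and y: "\<bar>foldr F (k # v) x - foldr F' (k # v) x'\<bar> \<le> e"
    and x: "\<bar>x - x'\<bar> \<le> D"
  shows "\<bar>\<tau> k - \<tau>' k\<bar> \<le> (2 * e + prod_list (map \<rho> (k # v)) * D) / (1 - 2 * r)"
proof -
  define \<Delta> where "\<Delta> = \<bar>\<tau> k - \<tau>' k\<bar>"
  let ?y = "foldr F v x" and ?y' = "foldr F' v x'" and ?q = "prod_list (map \<rho> v)"
  have k: "k \<in> K" and v: "set v \<subseteq> K" using w by auto
  have e: "0 \<le> e" and \<Delta>: "0 \<le> \<Delta>" using y by (auto simp: \<Delta>_def)
  have "\<bar>\<tau> i - \<tau>' i\<bar> \<le> e + \<Delta>" if "i \<in> K" for i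
    using \<tau>[of i] that e \<Delta> by (cases "i = k") (auto simp: \<Delta>_def)
  \<comment> \<open>The shape of the map contributes \<open>e\<close>, its translation
    \<open>e + \<Delta>\<close>.\<close>
  then have F: "\<bar>F i x - F' i x\<bar> \<le> 2 * e + \<Delta>" if "i \<in> K" for i x
    using close[OF that, of x] that by fastforce
  have q: "0 \<le> ?q" using v \<rho> by (intro prod_list_nonneg) auto
  have "\<bar>?y - ?y'\<bar> \<le> (2 * e + \<Delta>) / (1 - r) + ?q * \<bar>x - x'\<bar>"
    by (rule foldr_perturbation[OF _ \<rho> lip F]) (use r e \<Delta> v in auto)
  also have "\<dots> \<le> (2 * e + \<Delta>) / (1 - r) + ?q * D"
    using x q by (intro add_left_mono mult_left_mono) auto
  finally have *: "\<bar>?y - ?y'\<bar> \<le> (2 * e + \<Delta>) / (1 - r) + ?q * D" .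
  have "\<Delta> \<le> 2 * e + \<bar>F' k ?y - F' k ?y'\<bar>"
    using close[OF k, of ?y] y by (auto simp: \<Delta>_def)
  also have "\<dots> \<le> 2 * e + \<rho> k * ((2 * e + \<Delta>) / (1 - r) + ?q * D)"
    using * lip[OF k] \<rho>[OF k] by (meson add_left_mono mult_left_mono order.trans)
  also have "\<dots> = 2 * e + \<rho> k * ((2 * e + \<Delta>) / (1 - r)) + prod_list (map \<rho> (k # v)) * D"
    by (simp add: algebra_simps)
  also have "\<dots> \<le> 2 * e + r * ((2 * e + \<Delta>) / (1 - r)) + prod_list (map \<rho> (k # v)) * D"
    using \<rho>[OF k] e \<Delta> r by (intro add_right_mono add_left_mono mult_right_mono) auto
  \<comment> \<open>Clearing the denominator turns the influence of the later letters into
    \<open>r * \<Delta>\<close>, which is absorbed on the left; the remaining factor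
    \<open>1 - 2 * r\<close> is positive.\<close>
  finally have "\<Delta> * (1 - r) \<le> (2 * e + r * ((2 * e + \<Delta>) / (1 - r)) + prod_list (map \<rho> (k # v)) * D) * (1 - r)"
    using r by (intro mult_right_mono) auto
  also have "\<dots> = 2 * e + r * \<Delta> + prod_list (map \<rho> (k # v)) * D * (1 - r)"
    using r by (simp add: field_simps)
  also have "\<dots> \<le> 2 * e + r * \<Delta> + prod_list (map \<rho> (k # v)) * D * 1"
  proof (intro add_left_mono mult_left_mono)
    have "0 \<le> r" using \<rho>[OF k] by auto
    then show "1 - r \<le> 1" by simp
    have "0 \<le> D" using x by linarith
    then show "0 \<le> prod_list (map \<rho> (k # v)) * D" using q \<rho>[OF k] by simp
  qed
  finally have "\<Delta> * (1 - 2 * r) \<le> 2 * e + prod_list (map \<rho> (k # v)) * D" by (simp add: algebra_simps)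
  then show ?thesis using r by (simp add: \<Delta>_def field_simps)
qed

section \<open>Dependence of piecewise linear maps on their data\<close>

text \<open>A hinge \<open>max 0 (x - \<beta> i)\<close> produces the change of slope at
  \<open>\<beta> i\<close>, and subtracting \<open>g 0\<close> enforces the value \<open>t\<close>
  at 0. The formula makes the dependence on \<open>x\<close> and on \<open>\<beta>\<close>
  explicit.\<close>

lemma cpl_map_eq:
  fixes \<sigma> :: "nat \<Rightarrow> real"
  assumes mono: "strict_mono_on {1..n} \<beta>"
  defines "g \<equiv> \<lambda>x. \<sigma> 1 * x + (\<Sum>i=1..n. (\<sigma> (i + 1) - \<sigma> i) * max 0 (x - \<beta> i))"
  shows "cpl_map n \<beta> \<sigma> t x = t + (g x - g 0)"
proof -
  have "is_cpl_map n \<beta> \<sigma> t (\<lambda>x. t + (g x - g 0))"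
    unfolding is_cpl_map_def
  proof (intro conjI ballI)
    show "continuous_on UNIV (\<lambda>x. t + (g x - g 0))"
      unfolding g_def by (intro continuous_intros)
    fix j x assume j: "j \<in> {1..n + 1}" and x: "x \<in> lin_interval n \<beta> j"
    have side: "if i < j then \<beta> i < x else x < \<beta> i" if i: "i \<in> {1..n}" for i
    proof (cases "i < j")
      case True
      then have "\<beta> i \<le> \<beta> (j - 1)" "\<beta> (j - 1) < x"
        using strict_mono_onD[OF mono, of i "j - 1"] i j x
        by (cases "i = j - 1"; force simp: lin_interval_def)+
      then show ?thesis using True by simp
    next
      case False
      then have "x < \<beta> j" "\<beta> j \<le> \<beta> i"
        using strict_mono_onD[OF mono, of j i] i j x
        by (cases "i = j"; force simp: lin_interval_def)+
      then show ?thesis using False by simp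
    qed
    have hinge: "((\<lambda>x. max 0 (x - \<beta> i)) has_real_derivative of_bool (i < j)) (at x)"
      if "i \<in> {1..n}" for i
    proof (cases "i < j")
      case True
      have "((\<lambda>x. x - \<beta> i) has_real_derivative 1) (at x)" by (auto intro!: derivative_eq_intros)
      then show ?thesis
        using True side[OF that]
        by (auto intro: has_field_derivative_transform_within_open[of _ _ _ "{\<beta> i<..}"])
    next
      case False
      have "((\<lambda>x. max 0 (x - \<beta> i)) has_real_derivative 0) (at x)"
        by (rule has_field_derivative_transform_within_open[of "\<lambda>x. 0" _ _ "{..<\<beta> i}"])
           (use False side[OF that] in auto)
      then show ?thesis using False by simp
    qed
    have "(\<Sum>i=1..n. (\<sigma> (i + 1) - \<sigma> i) * of_bool (i < j)) = (\<Sum>i=1..<j. \<sigma> (i + 1) - \<sigma> i)"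
      by (rule sum.mono_neutral_cong_right) (use j in auto)
    also have "\<dots> = \<sigma> j - \<sigma> 1" using sum_Suc_diff'[of 1 j \<sigma>] j by simp
    \<comment> \<open>The right-hand side has the shape in which the differentiation rules deliver
      it.\<close>
    finally have "\<sigma> j = 0 + (\<sigma> 1 * 1 + (\<Sum>i=1..n. (\<sigma> (i + 1) - \<sigma> i) * of_bool (i < j)) - 0)"
      by simp
    then show "((\<lambda>x. t + (g x - g 0)) has_real_derivative \<sigma> j) (at x)"
      unfolding g_def by (auto intro!: DERIV_add DERIV_diff DERIV_sum DERIV_cmult hinge DERIV_ident simp only: DERIV_const)
  qed simp
  with is_cpl_map_cpl_map[OF mono] have "cpl_map n \<beta> \<sigma> t = (\<lambda>x. t + (g x - g 0))"
    by (rule cpl_map_unique)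
  then show ?thesis by (rule fun_cong)
qed

text \<open>Abel summation: the left-hand side combines the slopes with the nonnegative weights
  \<open>D - d 1, d 1 - d 2, \<dots>, d (n - 1) - d n, d n\<close>, whose sum is \<open>D\<close>.\<close>
lemma abel_slope_bound:
  fixes \<sigma> d :: "nat \<Rightarrow> real"
  assumes \<sigma>: "\<And>i. i \<in> {1..n + 1} \<Longrightarrow> \<bar>\<sigma> i\<bar> \<le> r"
    and d: "\<And>i. i \<in> {1..n} \<Longrightarrow> d i \<le> D" "\<And>i j. 1 \<le> i \<Longrightarrow> i \<le> j \<Longrightarrow> j \<le> n \<Longrightarrow> d j \<le> d i"
      "0 \<le> D" "\<And>i. i \<in> {1..n} \<Longrightarrow> 0 \<le> d i"
  shows "\<bar>\<sigma> 1 * D + (\<Sum>i=1..n. (\<sigma> (i + 1) - \<sigma> i) * d i)\<bar> \<le> r * D"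
proof -
  \<comment> \<open>\<open>D\<close> serves as \<open>d 0\<close>. The expression bounded next is
    then the sum of \<open>\<sigma> i * (e (i - 1) - e i)\<close> over \<open>i\<close> from 1 to
    \<open>j\<close>, with weights summing to \<open>D - e j\<close>.\<close>
  define e where "e i = (if i = 0 then D else d i)" for i
  have "\<bar>\<sigma> 1 * D + (\<Sum>i=1..j. (\<sigma> (i + 1) - \<sigma> i) * d i) - \<sigma> (j + 1) * e j\<bar> \<le> r * (D - e j)"
    if "j \<le> n" for j
    using that
  proof (induction j)
    case (Suc j)
    have "\<bar>\<sigma> (Suc j) * (e j - e (Suc j))\<bar> \<le> r * (e j - e (Suc j))"
      using \<sigma>[of "Suc j"] d(1)[of "Suc j"] d(2)[of j "Suc j"] Suc.prems
      by (auto simp: abs_mult e_def intro!: mult_mono)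
    moreover have "\<sigma> 1 * D + (\<Sum>i=1..Suc j. (\<sigma> (i + 1) - \<sigma> i) * d i) - \<sigma> (Suc j + 1) * e (Suc j)
      = (\<sigma> 1 * D + (\<Sum>i=1..j. (\<sigma> (i + 1) - \<sigma> i) * d i) - \<sigma> (j + 1) * e j)
        + \<sigma> (Suc j) * (e j - e (Suc j))"
      by (simp add: e_def algebra_simps)
    ultimately show ?case using Suc by (simp add: algebra_simps)
  qed (simp add: e_def)
  from this[of n] have "\<bar>\<sigma> 1 * D + (\<Sum>i=1..n. (\<sigma> (i + 1) - \<sigma> i) * d i) - \<sigma> (n + 1) * e n\<bar>
      \<le> r * (D - e n)" by simp
  moreover have "\<bar>\<sigma> (n + 1) * e n\<bar> \<le> r * e n"
    using \<sigma>[of "n + 1"] d(3) d(4)[of n] by (auto simp: abs_mult e_def intro!: mult_right_mono)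
  ultimately show ?thesis by (simp add: algebra_simps)
qed

text \<open>For \<open>y \<le> x\<close> the increment of the hinge at \<open>\<beta> i\<close> is
  the length of the part of \<open>[y, x]\<close> to the right of \<open>\<beta> i\<close>, hence
  nonincreasing in \<open>i\<close> and at most \<open>x - y\<close>. Abel summation then gives the
  constant \<open>r\<close> instead of a sum of slope jumps.\<close>

lemma cpl_map_lipschitz:
  assumes mono: "strict_mono_on {1..n} \<beta>" and \<sigma>: "\<And>i. i \<in> {1..n + 1} \<Longrightarrow> \<bar>\<sigma> i\<bar> \<le> r"
  shows "\<bar>cpl_map n \<beta> \<sigma> t x - cpl_map n \<beta> \<sigma> t y\<bar> \<le> r * \<bar>x - y\<bar>"
proof -
  have "\<bar>cpl_map n \<beta> \<sigma> t x - cpl_map n \<beta> \<sigma> t y\<bar> \<le> r * (x - y)" if "y \<le> x" for x y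
  proof -
    have \<beta>: "\<beta> i \<le> \<beta> j" if "1 \<le> i" "i \<le> j" "j \<le> n" for i j
      using strict_mono_onD[OF mono, of i j] that by (cases "i = j") auto
    have "cpl_map n \<beta> \<sigma> t x - cpl_map n \<beta> \<sigma> t y
      = \<sigma> 1 * (x - y) + (\<Sum>i=1..n. (\<sigma> (i + 1) - \<sigma> i) * (max 0 (x - \<beta> i) - max 0 (y - \<beta> i)))"
      by (simp add: cpl_map_eq[OF mono] right_diff_distrib sum_subtractf)
    also have "\<bar>\<dots>\<bar> \<le> r * (x - y)"
    proof (rule abel_slope_bound[OF \<sigma>])
      show "max 0 (x - \<beta> j) - max 0 (y - \<beta> j) \<le> max 0 (x - \<beta> i) - max 0 (y - \<beta> i)"
        if "1 \<le> i" "i \<le> j" "j \<le> n" for i j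
        using \<beta>[OF that] \<open>y \<le> x\<close> by linarith
    qed (use that in auto)
    finally show ?thesis .
  qed
  from this[of x y] this[of y x] show ?thesis by (cases "x \<le> y") (auto simp: abs_minus_commute)
qed

text \<open>A slope jump is at most 2 and a displaced hinge enters twice, at \<open>x\<close> and
  through the normalisation at 0; hence the factor 4. Uniformity in \<open>x\<close> holds because a
  hinge is 1-Lipschitz in its breaking point.\<close>

lemma cpl_map_perturbation:
  assumes mono: "strict_mono_on {1..n} \<beta>" "strict_mono_on {1..n} \<beta>'"
    and \<sigma>: "\<And>i. i \<in> {1..n + 1} \<Longrightarrow> \<bar>\<sigma> i\<bar> \<le> 1"
  shows "\<bar>(cpl_map n \<beta> \<sigma> t x - t) - (cpl_map n \<beta>' \<sigma> t' x - t')\<bar> \<le> 4 * (\<Sum>i=1..n. \<bar>\<beta> i - \<beta>' i\<bar>)"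
proof -
  have hinge: "\<bar>max 0 (y - a) - max 0 (y - b)\<bar> \<le> \<bar>a - b\<bar>" for a b y :: real
    by (auto simp: max_def)
  have diff: "\<bar>p\<bar> \<le> D \<Longrightarrow> \<bar>q\<bar> \<le> D \<Longrightarrow> \<bar>p - q\<bar> \<le> 2 * D" for p q D :: real
    by linarith
  have "(cpl_map n \<beta> \<sigma> t x - t) - (cpl_map n \<beta>' \<sigma> t' x - t')
    = (\<Sum>i=1..n. (\<sigma> (i + 1) - \<sigma> i) *
        ((max 0 (x - \<beta> i) - max 0 (x - \<beta>' i)) - (max 0 (- \<beta> i) - max 0 (- \<beta>' i))))"
    unfolding mono[THEN cpl_map_eq] by (simp add: right_diff_distrib sum_subtractf)
  also have "\<bar>\<dots>\<bar> \<le> (\<Sum>i=1..n. 2 * (2 * \<bar>\<beta> i - \<beta>' i\<bar>))"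
  proof (rule order_trans[OF sum_abs sum_mono])
    fix i assume i: "i \<in> {1..n}"
    have "\<bar>\<sigma> (i + 1) - \<sigma> i\<bar> \<le> 2" using \<sigma>[of i] \<sigma>[of "i + 1"] i by auto
    moreover have "\<bar>(max 0 (x - \<beta> i) - max 0 (x - \<beta>' i)) - (max 0 (- \<beta> i) - max 0 (- \<beta>' i))\<bar>
      \<le> 2 * \<bar>\<beta> i - \<beta>' i\<bar>"
      using diff[OF hinge[of x "\<beta> i" "\<beta>' i"] hinge[of 0 "\<beta> i" "\<beta>' i"]] unfolding diff_0 .
    ultimately show "\<bar>(\<sigma> (i + 1) - \<sigma> i) *
        ((max 0 (x - \<beta> i) - max 0 (x - \<beta>' i)) - (max 0 (- \<beta> i) - max 0 (- \<beta>' i)))\<bar>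
      \<le> 2 * (2 * \<bar>\<beta> i - \<beta>' i\<bar>)"
      unfolding abs_mult by (intro mult_mono) auto
  qed
  finally show ?thesis by (simp add: sum_distrib_left)
qed

section \<open>Packing dimension from counting separated sets\<close>

lemma geometric_scale_exists:
  fixes a r :: real
  assumes a: "1 < a" and r: "0 < r" "r \<le> 1 / a ^ q0"
  shows "\<exists>q\<ge>q0. 1 / a ^ Suc q < r \<and> r \<le> 1 / a ^ q"
proof -
  obtain n where "1 / r < a ^ n" using real_arch_pow[OF a] by blast
  then have n: "1 / a ^ n < r" using a r by (simp add: field_simps)
  define p where "p = (LEAST p. 1 / a ^ p < r)"
  have p: "1 / a ^ p < r" unfolding p_def using n by (rule LeastI)
  have "q0 < p"
  proof (rule ccontr)
    assume "\<not> q0 < p"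
    then have "1 / a ^ q0 \<le> 1 / a ^ p" using a by (intro divide_left_mono power_increasing) auto
    then show False using p r by linarith
  qed
  then obtain q where q: "p = Suc q" "q0 \<le> q" by (cases p) auto
  have "\<not> 1 / a ^ q < r" using not_less_Least[of q "\<lambda>p. 1 / a ^ p < r"] q p_def by simp
  then show ?thesis using p q by auto
qed

context Metric_space
begin

lemma is_packing_separated:
  assumes C: "is_packing M d A \<delta> C" and "A \<subseteq> M"
    and p: "(x, r) \<in> C" "(y, s) \<in> C" "(x, r) \<noteq> (y, s)"
  shows "r < d x y" "s < d x y"
proof -
  have xy: "x \<in> M" "y \<in> M" "0 < r" "0 < s" using C p assms(2) unfolding is_packing_def by auto
  have "mcball x r \<inter> mcball y s = {}"
    using C p unfolding is_packing_def disjoint_family_on_def by fastforce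
  moreover have "x \<in> mcball x r" "y \<in> mcball y s" using xy by auto
  ultimately have "x \<notin> mcball y s" "y \<notin> mcball x r" by blast+
  then show "r < d x y" "s < d x y" using xy by (auto simp: commute)
qed

text \<open>Sort the balls of a packing by radius into classes between \<open>1 / a ^ Suc q\<close>
  and \<open>1 / a ^ q\<close>. The centres in one class are separated, so \<open>count\<close>
  bounds its contribution by \<open>C * 2 powr s * \<kappa> ^ q\<close> with
  \<open>\<kappa> = a powr (N - s) * \<theta> < 1\<close>. The classes from \<open>Q\<close> on form
  a geometric tail, which vanishes as the scale \<open>1 / a ^ Q\<close> shrinks.\<close>

lemma packing_premeasure_eq_0:
  fixes a \<theta> N s C :: real
  assumes A: "A \<subseteq> M" and a: "1 < a" and \<theta>: "0 < \<theta>" "a powr (N - s) * \<theta> < 1"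
    and s: "0 \<le> s" and C: "0 \<le> C"
    and count: "\<And>q S. \<lbrakk>q0 \<le> q; finite S; S \<subseteq> A;
        \<And>x y. x \<in> S \<Longrightarrow> y \<in> S \<Longrightarrow> x \<noteq> y \<Longrightarrow> 1 / a ^ Suc q < d x y\<rbrakk> \<Longrightarrow>
        real (card S) \<le> C * (a powr N * \<theta>) ^ q"
  shows "packing_premeasure M d s A = 0"
proof -
  define \<kappa> where "\<kappa> = a powr (N - s) * \<theta>"
  have \<kappa>: "0 < \<kappa>" "\<kappa> < 1" using a \<theta> by (auto simp: \<kappa>_def)
  define B where "B = C * 2 powr s / (1 - \<kappa>)"
  have fin: "(\<Sum>(x, r)\<in>F. (2 * r) powr s) \<le> B * \<kappa> ^ Q"
    if Q: "q0 \<le> Q" and P: "is_packing M d A (1 / a ^ Q) P" and F: "finite F" "F \<subseteq> P" for Q P F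
  proof -
    have F': "x \<in> A \<and> 0 < r \<and> r \<le> 1 / a ^ Q" if "(x, r) \<in> F" for x r
      using P F that unfolding is_packing_def by auto
    define scale where "scale r = (SOME q. Q \<le> q \<and> 1 / a ^ Suc q < r \<and> r \<le> 1 / a ^ q)" for r
    have scale: "Q \<le> scale r \<and> 1 / a ^ Suc (scale r) < r \<and> r \<le> 1 / a ^ scale r" if "(x, r) \<in> F" for x r
      unfolding scale_def using geometric_scale_exists[OF a] F'[OF that] by (rule_tac someI_ex) blast
    define G where "G q = {p \<in> F. scale (snd p) = q}" for q
    have G: "(\<Sum>(x, r)\<in>G q. (2 * r) powr s) \<le> C * 2 powr s * \<kappa> ^ q" if "Q \<le> q" for q
    proof -
      have sep: "x \<noteq> y \<and> 1 / a ^ Suc q < d x y" if "(x, r) \<in> G q" "(y, u) \<in> G q" "(x, r) \<noteq> (y, u)" for x y r u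
      proof -
        have "r < d x y" using is_packing_separated[OF P A, of x r y u] that F by (auto simp: G_def)
        moreover have "1 / a ^ Suc q < r" "0 < r" using scale F' that by (auto simp: G_def)
        moreover have "x \<in> M" using that F' A by (auto simp: G_def)
        ultimately show ?thesis by (auto simp: mdist_zero)
      qed
      \<comment> \<open>No centre occurs with two radii, so counting balls amounts to counting
        centres.\<close>
      have inj: "inj_on fst (G q)" using sep by (intro inj_onI) fastforce
      have "real (card (fst ` G q)) \<le> C * (a powr N * \<theta>) ^ q"
      proof (rule count)
        show "q0 \<le> q" "finite (fst ` G q)" using Q \<open>Q \<le> q\<close> F by (auto simp: G_def)
        show "fst ` G q \<subseteq> A" using F' by (auto simp: G_def)
        show "1 / a ^ Suc q < d x y" if "x \<in> fst ` G q" "y \<in> fst ` G q" "x \<noteq> y" for x y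
          using sep that by fastforce
      qed
      then have card: "real (card (G q)) \<le> C * (a powr N * \<theta>) ^ q" using card_image[OF inj] by simp
      have "(\<Sum>(x, r)\<in>G q. (2 * r) powr s) \<le> (\<Sum>(x, r)\<in>G q. (2 * (1 / a ^ q)) powr s)"
      proof (intro sum_mono, clarify)
        fix x r assume p: "(x, r) \<in> G q"
        then have "0 < r" "r \<le> 1 / a ^ q" using scale[of x r] F'[of x r] by (auto simp: G_def)
        then show "(2 * r) powr s \<le> (2 * (1 / a ^ q)) powr s" using s by (intro powr_mono2) auto
      qed
      also have "\<dots> = real (card (G q)) * (2 * (1 / a ^ q)) powr s" by (simp add: case_prod_beta)
      also have "\<dots> \<le> (C * (a powr N * \<theta>) ^ q) * (2 * (1 / a ^ q)) powr s"
        using card by (intro mult_right_mono) auto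
      also have "(2 * (1 / a ^ q)) powr s = 2 powr s * (a powr (- s)) ^ q"
      proof -
        have "1 / a ^ q = a powr (- real q)" using a by (simp add: powr_minus_divide powr_realpow)
        moreover have "(a powr (- s)) ^ q = a powr (- s * real q)"
          using a by (simp add: powr_powr flip: powr_realpow)
        ultimately show ?thesis by (simp add: powr_mult powr_powr mult.commute)
      qed
      also have "C * (a powr N * \<theta>) ^ q * (2 powr s * (a powr (- s)) ^ q)
          = C * 2 powr s * (a powr N * \<theta> * a powr (- s)) ^ q"
        by (simp add: power_mult_distrib)
      also have "a powr N * \<theta> * a powr (- s) = \<kappa>"
        using a by (simp add: \<kappa>_def powr_diff powr_minus field_simps)
      finally show ?thesis .
    qed
    define T where "T = scale ` snd ` F"
    have T: "finite T" "T \<subseteq> {Q..}" using F scale by (auto simp: T_def)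
    \<comment> \<open>A finite part of the packing occupies finitely many classes, so its sum is
      compared with a partial sum of the geometric series.\<close>
    obtain n where n: "T \<subseteq> {Q..<Q + n}"
    proof -
      obtain b where "\<forall>x\<in>T. x \<le> b" using T(1) finite_nat_set_iff_bounded_le by auto
      then have "T \<subseteq> {Q..<Q + Suc b}" using T by fastforce
      then show ?thesis by (rule that)
    qed
    have "(\<Sum>(x, r)\<in>F. (2 * r) powr s) = (\<Sum>q\<in>{Q..<Q + n}. \<Sum>(x, r)\<in>G q. (2 * r) powr s)"
      unfolding G_def using n F(1) by (intro sum.group[symmetric]) (auto simp: T_def)
    also have "\<dots> \<le> (\<Sum>q\<in>{Q..<Q + n}. C * 2 powr s * \<kappa> ^ q)"
      using G by (intro sum_mono) auto
    also have "\<dots> = C * 2 powr s * \<kappa> ^ Q * (\<Sum>q<n. \<kappa> ^ q)"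
    proof -
      have "(\<Sum>q\<in>{Q..<Q + n}. \<kappa> ^ q) = \<kappa> ^ Q * (\<Sum>q<n. \<kappa> ^ q)"
        using sum.shift_bounds_nat_ivl[of "\<lambda>q. \<kappa> ^ q" 0 Q n]
        by (simp add: atLeast0LessThan power_add sum_distrib_left mult.commute add.commute)
      then show ?thesis by (simp add: mult.assoc flip: sum_distrib_left)
    qed
    also have "\<dots> \<le> C * 2 powr s * \<kappa> ^ Q * (1 / (1 - \<kappa>))"
      using \<kappa> C by (intro mult_left_mono) (auto simp: sum_gp_strict divide_right_mono)
    finally show ?thesis by (simp add: B_def mult_ac)
  qed
  have scale_le: "packing_premeasure_scale M d s (1 / a ^ Q) A \<le> ennreal (B * \<kappa> ^ Q)" if "q0 \<le> Q" for Q
    unfolding packing_premeasure_scale_def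
  proof (rule SUP_least)
    fix P assume "P \<in> {P. is_packing M d A (1 / a ^ Q) P}"
    then have P: "is_packing M d A (1 / a ^ Q) P" by simp
    show "(\<Sum>\<^sub>\<infinity>(x, r)\<in>P. ennreal ((2 * r) powr s)) \<le> ennreal (B * \<kappa> ^ Q)"
    proof (rule infsum_le_finite_sums)
      fix F assume F: "finite F" "F \<subseteq> P"
      have "(\<Sum>(x, r)\<in>F. ennreal ((2 * r) powr s)) = ennreal (\<Sum>(x, r)\<in>F. (2 * r) powr s)"
        by (simp add: case_prod_beta sum_ennreal)
      also have "\<dots> \<le> ennreal (B * \<kappa> ^ Q)" using fin[OF that P F] by (rule ennreal_leI)
      finally show "(\<Sum>(x, r)\<in>F. ennreal ((2 * r) powr s)) \<le> ennreal (B * \<kappa> ^ Q)" .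
    qed (simp add: nonneg_summable_on_complete)
  qed
  have "packing_premeasure M d s A \<le> ennreal (B * \<kappa> ^ Q)" if "q0 \<le> Q" for Q
    unfolding packing_premeasure_def
    by (rule INF_lower2[of "1 / a ^ Q"]) (use a scale_le[OF that] in auto)
  then have "\<forall>\<^sub>F Q in sequentially. packing_premeasure M d s A \<le> ennreal (B * \<kappa> ^ Q)"
    by (auto intro: eventually_sequentiallyI)
  moreover have "(\<lambda>Q. ennreal (B * \<kappa> ^ Q)) \<longlonglongrightarrow> ennreal (B * 0)"
    using \<kappa> by (intro tendsto_ennrealI tendsto_mult_left LIMSEQ_power_zero) auto
  ultimately have "packing_premeasure M d s A \<le> ennreal (B * 0)"
    by (intro tendsto_lowerbound[where F=sequentially]) auto
  then show ?thesis by simp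
qed

section \<open>From vanishing premeasures to a strict dimension bound\<close>

lemma packing_dim_le_of_cover:
  fixes A :: "nat \<Rightarrow> 'a set"
  assumes "0 \<le> s" and "E \<subseteq> (\<Union>n. A n)" and "\<And>n. A n \<subseteq> M"
    and "\<And>n. packing_premeasure M d s (A n) = 0"
  shows "packing_dim M d E \<le> ereal s"
proof -
  have "packing_measure M d s E \<le> (\<Sum>n. packing_premeasure M d s (A n))"
    unfolding packing_measure_def by (rule INF_lower) (use assms in auto)
  then have "packing_measure M d s E = 0" using assms by simp
  then show ?thesis unfolding packing_dim_def using assms(1) by (intro Inf_lower) auto
qed

text \<open>The factor \<open>\<theta> ^ q\<close> gained in the count leaves room to lower the
  exponent from \<open>N\<close> to \<open>N - t\<close> with
  \<open>a powr t * \<theta> < 1\<close>. While \<open>C\<close> and \<open>q0\<close> may vary with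
  the piece, \<open>t\<close> is common to all pieces, so the strict inequality survives the
  countable union.\<close>

lemma packing_dim_less_of_counting:
  fixes a \<theta> N :: real and A :: "nat \<Rightarrow> 'a set"
  assumes a: "1 < a" and \<theta>: "0 < \<theta>" "\<theta> < 1" and N: "0 < N"
    and cover: "E \<subseteq> (\<Union>n. A n)" "\<And>n. A n \<subseteq> M"
    and count: "\<And>n. \<exists>C\<ge>0. \<exists>q0. \<forall>q\<ge>q0. \<forall>S. finite S \<longrightarrow> S \<subseteq> A n \<longrightarrow>
        (\<forall>x\<in>S. \<forall>y\<in>S. x \<noteq> y \<longrightarrow> 1 / a ^ Suc q < d x y) \<longrightarrow>
        real (card S) \<le> C * (a powr N * \<theta>) ^ q"
  shows "packing_dim M d E < ereal N"
proof -
  define b c where "b = - ln \<theta>" and "c = ln a"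
  have bc: "0 < b" "0 < c" using a \<theta> by (simp_all add: b_def c_def)
  \<comment> \<open>Half of the critical value \<open>- ln \<theta> / ln a\<close>, capped at
    \<open>N\<close> so that the exponent \<open>N - t\<close> stays nonnegative.\<close>
  define t where "t = min N (b / (2 * c))"
  have t: "0 < t" "t \<le> N" "t \<le> b / (2 * c)" using N bc by (simp_all add: t_def)
  have "t * c \<le> b / (2 * c) * c" using t bc by (intro mult_right_mono) simp_all
  also have "\<dots> < b" using bc by simp
  finally have "exp (t * c - b) < 1" by simp
  also have "exp (t * c - b) = a powr (N - (N - t)) * \<theta>"
    using a \<theta> by (simp add: exp_add powr_def b_def c_def)
  finally have small: "a powr (N - (N - t)) * \<theta> < 1" .
  have Nt: "0 \<le> N - t" using t by simp
  have "packing_premeasure M d (N - t) (A n) = 0" for n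
  proof -
    obtain C q0 where "0 \<le> C" and C: "\<forall>q\<ge>q0. \<forall>S. finite S \<longrightarrow> S \<subseteq> A n \<longrightarrow>
        (\<forall>x\<in>S. \<forall>y\<in>S. x \<noteq> y \<longrightarrow> 1 / a ^ Suc q < d x y) \<longrightarrow>
        real (card S) \<le> C * (a powr N * \<theta>) ^ q"
      using count[of n] by (elim exE conjE) (rule that)
    show ?thesis
      by (rule packing_premeasure_eq_0[OF cover(2) a \<theta>(1) small Nt \<open>0 \<le> C\<close>])
         (rule C[rule_format])
  qed
  then have "packing_dim M d E \<le> ereal (N - t)"
    using cover Nt by (intro packing_dim_le_of_cover) auto
  also have "\<dots> < ereal N" using t by simp
  finally show ?thesis .
qed

end

section \<open>Counting\<close>

text \<open>Multiplying out the power yields one term per word; applied to the contraction rates, it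
  makes the total thickness of the tubes decay geometrically.\<close>

lemma sum_prod_list_words:
  fixes \<rho> :: "'k \<Rightarrow> 'a::comm_semiring_1"
  shows "(\<Sum>w\<in>{w. set w \<subseteq> K \<and> length w = n}. prod_list (map \<rho> w)) = (\<Sum>k\<in>K. \<rho> k) ^ n"
proof (induction n)
  case 0
  have "{w. set w \<subseteq> K \<and> length w = 0} = {[]}" by auto
  then show ?case by simp
next
  case (Suc n)
  let ?W = "\<lambda>n. {w. set w \<subseteq> K \<and> length w = n}"
  have "?W (Suc n) = (\<lambda>(k, w). k # w) ` (K \<times> ?W n)"
    by (force simp: length_Suc_conv image_iff)
  then have "(\<Sum>w\<in>?W (Suc n). prod_list (map \<rho> w)) = (\<Sum>(k, w)\<in>K \<times> ?W n. \<rho> k * prod_list (map \<rho> w))"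
    by (simp add: sum.reindex inj_on_def case_prod_beta)
  also have "\<dots> = (\<Sum>k\<in>K. \<rho> k) ^ Suc n"
    by (simp add: sum_product Suc.IH flip: sum.cartesian_product Suc.IH)
  finally show ?case .
qed

lemma floor_cell_dist:
  fixes x y u :: real
  assumes "0 < u" "\<lfloor>x / u\<rfloor> = \<lfloor>y / u\<rfloor>"
  shows "\<bar>x - y\<bar> \<le> u"
proof -
  have "\<bar>x / u - y / u\<bar> \<le> 1" using assms(2) by linarith
  then have "\<bar>x - y\<bar> / u \<le> 1" using assms(1) by (simp add: abs_divide flip: diff_divide_distrib)
  then show ?thesis using assms(1) by simp
qed

text \<open>Rounding can raise a difference of cell numbers to
  \<open>\<lfloor>T / u\<rfloor> + 1\<close>, and counting both end cells adds one more; hence the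
  summand 2.\<close>

lemma card_le_of_floor_inj:
  fixes f :: "'p \<Rightarrow> real"
  assumes S: "finite S" and u: "0 < u" and T: "0 \<le> T"
    and inj: "inj_on (\<lambda>p. \<lfloor>f p / u\<rfloor>) S"
    and diam: "\<And>p q. p \<in> S \<Longrightarrow> q \<in> S \<Longrightarrow> \<bar>f p - f q\<bar> \<le> T"
  shows "real (card S) \<le> T / u + 2"
proof (cases "S = {}")
  case False
  define Z where "Z = (\<lambda>p. \<lfloor>f p / u\<rfloor>) ` S"
  have Z: "finite Z" "Z \<noteq> {}" using S False by (auto simp: Z_def)
  have dZ: "y - z \<le> \<lfloor>T / u\<rfloor> + 1" if yz: "y \<in> Z" "z \<in> Z" for y z
  proof -
    obtain p q where pq: "p \<in> S" "y = \<lfloor>f p / u\<rfloor>" "q \<in> S" "z = \<lfloor>f q / u\<rfloor>"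
      using yz by (auto simp: Z_def)
    have "f p - f q \<le> T" using diam[OF pq(1,3)] by linarith
    then have "f p / u - f q / u \<le> T / u"
      using u by (simp add: divide_right_mono flip: diff_divide_distrib)
    then show ?thesis unfolding pq by linarith
  qed
  have "Z \<subseteq> {Min Z..Min Z + (\<lfloor>T / u\<rfloor> + 1)}"
    using Z dZ[OF _ Min_in[OF Z]] by (force simp: algebra_simps)
  then have "card Z \<le> card {Min Z..Min Z + (\<lfloor>T / u\<rfloor> + 1)}" by (intro card_mono) auto
  also have "\<dots> = nat (\<lfloor>T / u\<rfloor> + 2)" by simp
  finally have "card Z \<le> nat (\<lfloor>T / u\<rfloor> + 2)" .
  moreover have "0 \<le> T / u" using T u by simp
  ultimately have "real (card Z) \<le> T / u + 2" by linarith
  then show ?thesis using card_image[OF inj] by (simp add: Z_def)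
qed (use T u in simp)

lemma card_le_card_image_times_fibre:
  fixes B :: real
  assumes S: "finite S" and B: "\<And>p. p \<in> S \<Longrightarrow> real (card {q \<in> S. f q = f p}) \<le> B"
  shows "real (card S) \<le> real (card (f ` S)) * B"
proof -
  have "real (card S) = (\<Sum>p\<in>S. 1)" by simp
  also have "\<dots> = (\<Sum>c\<in>f ` S. \<Sum>p\<in>{q \<in> S. f q = c}. 1)" by (rule sum.image_gen[OF S])
  also have "\<dots> \<le> (\<Sum>c\<in>f ` S. B)" using B by (intro sum_mono) auto
  finally show ?thesis by simp
qed

lemma card_grid_cells:
  fixes x :: "'p \<Rightarrow> 'i \<Rightarrow> real" and y :: "'p \<Rightarrow> 'j \<Rightarrow> real"
  assumes fin: "finite I" "finite J" and u: "0 < u" "u \<le> 1" and R: "0 \<le> R"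
    and x: "\<And>p i. p \<in> S \<Longrightarrow> i \<in> I \<Longrightarrow> \<bar>x p i\<bar> \<le> R"
    and y: "\<And>p j. p \<in> S \<Longrightarrow> j \<in> J \<Longrightarrow> \<bar>y p j\<bar> \<le> R"
  shows "real (card ((\<lambda>p. (\<lambda>i\<in>I. \<lfloor>x p i / u\<rfloor>, \<lambda>j\<in>J. \<lfloor>y p j / u\<rfloor>)) ` S))
    \<le> ((2 * R + 3) / u) ^ (card I + card J)"
proof -
  define Q where "Q = \<lceil>R / u\<rceil>"
  have cell: "\<lfloor>z / u\<rfloor> \<in> {- Q..Q}" if "\<bar>z\<bar> \<le> R" for z
  proof -
    have "\<bar>z / u\<bar> \<le> R / u" using that u by (simp add: abs_divide divide_right_mono)
    then show ?thesis unfolding Q_def atLeastAtMost_iff by linarith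
  qed
  have "card ((\<lambda>p. (\<lambda>i\<in>I. \<lfloor>x p i / u\<rfloor>, \<lambda>j\<in>J. \<lfloor>y p j / u\<rfloor>)) ` S)
    \<le> card ((I \<rightarrow>\<^sub>E {- Q..Q}) \<times> (J \<rightarrow>\<^sub>E {- Q..Q}))"
    using fin cell x y by (intro card_mono finite_cartesian_product finite_PiE) (auto simp del: atLeastAtMost_iff)
  also have "\<dots> = nat (2 * Q + 1) ^ (card I + card J)"
  proof -
    have "card {- Q..Q} = nat (2 * Q + 1)" by simp
    then show ?thesis using fin by (simp only: card_cartesian_product card_PiE prod_constant power_add)
  qed
  finally have "real (card ((\<lambda>p. (\<lambda>i\<in>I. \<lfloor>x p i / u\<rfloor>, \<lambda>j\<in>J. \<lfloor>y p j / u\<rfloor>)) ` S))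
      \<le> real (nat (2 * Q + 1)) ^ (card I + card J)"
    by (simp only: of_nat_le_iff flip: of_nat_power)
  also have "\<dots> \<le> ((2 * R + 3) / u) ^ (card I + card J)"
  proof (intro power_mono)
    have "0 \<le> R / u" using R u by simp
    then have "real (nat (2 * Q + 1)) \<le> 2 * (R / u) + 3" unfolding Q_def by linarith
    \<comment> \<open>Here \<open>u \<le> 1\<close> lets the rounding constant 3 scale like
      \<open>1 / u\<close>.\<close>
    also have "\<dots> \<le> 2 * (R / u) + 3 / u" using u by (simp add: le_divide_eq)
    also have "\<dots> = (2 * R + 3) / u" by (simp add: add_divide_distrib)
    finally show "real (nat (2 * Q + 1)) \<le> (2 * R + 3) / u" .
  qed simp
  finally show ?thesis .
qed

section \<open>Non-regular parameters\<close>

lemma finite_break_idx: "finite (break_idx m l)"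
  by (simp add: break_idx_def)

text \<open>By this comparison, parameters whose coordinates all differ by at most \<open>u\<close>
  are at distance at most \<open>(L + m) * u\<close>, the separation threshold used below.\<close>

lemma param_dist_le_sum:
  "param_dist m l (b, \<tau>) (b', \<tau>') \<le>
    (\<Sum>i\<in>break_idx m l. \<bar>b i - b' i\<bar>) + (\<Sum>k=1..m. \<bar>\<tau> k - \<tau>' k\<bar>)"
proof -
  have "param_dist m l (b, \<tau>) (b', \<tau>')
      \<le> euclid_dist (break_idx m l) b b' + euclid_dist {1..m} \<tau> \<tau>'"
    unfolding param_dist_def prod_dist_def
    by (simp add: euclid_dist_def sqrt_sum_squares_le_sum)
  also have "\<dots> \<le> (\<Sum>i\<in>break_idx m l. \<bar>b i - b' i\<bar>) + (\<Sum>k=1..m. \<bar>\<tau> k - \<tau>' k\<bar>)"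
    unfolding euclid_dist_def by (intro add_mono L2_set_le_sum_abs)
  finally show ?thesis .
qed

section \<open>Consequences of smallness\<close>

locale small_slopes =
  fixes m :: nat and l :: "nat \<Rightarrow> nat" and \<rho> :: "nat \<times> nat \<Rightarrow> real"
  assumes m: "2 \<le> m" and small: "\<rho> \<in> small_slope_vectors m l"
begin

abbreviation L :: nat where "L \<equiv> card (break_idx m l)"
abbreviation slope :: "nat \<Rightarrow> real" where "slope \<equiv> max_slope l \<rho>"
abbreviation rmax :: real where "rmax \<equiv> rho_max m l \<rho>"

lemma abs_slope_le: "i \<in> {1..l k + 1} \<Longrightarrow> \<bar>\<rho> (k, i)\<bar> \<le> slope k"
  unfolding max_slope_def by (intro Max_ge) auto

lemma slope_nonneg: "0 \<le> slope k"
  using abs_slope_le[of 1 k] by fastforce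

lemma slope_le_rmax: "k \<in> {1..m} \<Longrightarrow> slope k \<le> rmax"
  unfolding rho_max_def by (intro Max_ge) auto

lemma abs_rho_le_1: "k \<in> {1..m} \<Longrightarrow> i \<in> {1..l k + 1} \<Longrightarrow> \<bar>\<rho> (k, i)\<bar> \<le> 1"
proof -
  assume "k \<in> {1..m}" "i \<in> {1..l k + 1}"
  then have "(k, i) \<in> slope_idx m l" by (auto simp: slope_idx_def)
  then have "\<rho> (k, i) \<in> {-1<..<1} - {0}"
    using small unfolding small_slope_vectors_def slope_vectors_def by blast
  then show ?thesis by auto
qed

text \<open>Membership in \<open>small_slope_vectors\<close> quantifies over all parameters, so one
  parameter has to be exhibited: breaking points at consecutive integers and zero
  translations.\<close>

lemma some_small: "\<exists>b \<tau>. small_cplifs m l b \<tau> \<rho>"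
proof -
  let ?b = "\<lambda>p\<in>break_idx m l. real (snd p)"
  have "?b \<in> break_vectors m l"
    by (auto simp: break_vectors_def euclid_space_def break_idx_def strict_mono_on_def)
  moreover have "(\<lambda>k\<in>{1..m}. 0) \<in> translation_vectors m"
    by (simp add: translation_vectors_def euclid_space_def)
  ultimately show ?thesis using small unfolding small_slope_vectors_def by blast
qed

lemma sum_slope_less_1: "(\<Sum>k=1..m. slope k) < 1"
  using some_small unfolding small_cplifs_def by blast

text \<open>At an index attaining the maximum both clauses of smallness suffice, since
  \<open>(1 - rmax) / 2\<close> is at most 1/2.\<close>

lemma rmax_less_half: "rmax < 1 / 2"
proof -
  have "rmax \<in> slope ` {1..m}" unfolding rho_max_def using m by (intro Max_in) auto
  then obtain k where k: "k \<in> {1..m}" "rmax = slope k" by auto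
  have "0 \<le> rmax" using k slope_nonneg by simp
  moreover have "slope k < 1 / 2 \<or> slope k < (1 - rmax) / 2"
    using some_small k unfolding small_cplifs_def by blast
  ultimately show ?thesis using k by auto
qed

lemma rmax_nonneg: "0 \<le> rmax"
  using slope_nonneg[of 1] slope_le_rmax[of 1] m by auto

lemma cplifs_lipschitz:
  assumes "b \<in> break_vectors m l" "k \<in> {1..m}"
  shows "\<bar>cplifs l b \<tau> \<rho> k x - cplifs l b \<tau> \<rho> k y\<bar> \<le> slope k * \<bar>x - y\<bar>"
  unfolding cplifs_def
  by (rule cpl_map_lipschitz) (use assms abs_slope_le in \<open>auto simp: break_vectors_def\<close>)

lemma cplifs_0:
  assumes "b \<in> break_vectors m l" "k \<in> {1..m}"
  shows "cplifs l b \<tau> \<rho> k 0 = \<tau> k"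
  unfolding cplifs_def by (subst cpl_map_eq) (use assms in \<open>auto simp: break_vectors_def\<close>)

lemma cplifs_perturbation:
  assumes "b \<in> break_vectors m l" "b' \<in> break_vectors m l" "k \<in> {1..m}"
    and u: "\<And>i. i \<in> break_idx m l \<Longrightarrow> \<bar>b i - b' i\<bar> \<le> u" "0 \<le> u"
  shows "\<bar>(cplifs l b \<tau> \<rho> k x - \<tau> k) - (cplifs l b' \<tau>' \<rho> k x - \<tau>' k)\<bar> \<le> 4 * real L * u"
proof -
  have "\<bar>(cplifs l b \<tau> \<rho> k x - \<tau> k) - (cplifs l b' \<tau>' \<rho> k x - \<tau>' k)\<bar>
    \<le> 4 * (\<Sum>i=1..l k. \<bar>b (k, i) - b' (k, i)\<bar>)"
    unfolding cplifs_def
    by (rule cpl_map_perturbation) (use assms abs_rho_le_1 in \<open>auto simp: break_vectors_def\<close>)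
  also have "(\<Sum>i=1..l k. \<bar>b (k, i) - b' (k, i)\<bar>) \<le> real (card {1..l k}) * u"
    using assms(3) by (intro sum_bounded_above u) (auto simp: break_idx_def)
  also have "\<dots> \<le> real L * u"
  proof (intro mult_right_mono u)
    have "l k \<le> (\<Sum>k=1..m. l k)" using assms(3) by (intro member_le_sum) auto
    then have "card {1..l k} \<le> L" by (simp add: card_break_idx)
    then show "real (card {1..l k}) \<le> real L" by (simp only: of_nat_le_iff)
  qed
  finally show ?thesis by simp
qed

lemma attractor_invariant:
  assumes "b \<in> break_vectors m l"
  shows "attractor m (cplifs l b \<tau> \<rho>) = (\<Union>k\<in>{1..m}. cplifs l b \<tau> \<rho> k ` attractor m (cplifs l b \<tau> \<rho>))"
    and "\<lbrakk>\<And>k. k \<in> {1..m} \<Longrightarrow> \<bar>\<tau> k\<bar> \<le> R; x \<in> attractor m (cplifs l b \<tau> \<rho>)\<rbrakk> \<Longrightarrow> \<bar>x\<bar> \<le> 2 * R"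
proof -
  have contr: "\<bar>cplifs l b \<tau> \<rho> k x - cplifs l b \<tau> \<rho> k y\<bar> \<le> rmax * \<bar>x - y\<bar>"
    if "k \<in> {1..m}" for k x y
    using cplifs_lipschitz[OF assms that] slope_le_rmax[OF that]
    by (meson abs_ge_zero mult_right_mono order.trans)
  have r: "rmax < 1" "0 < m" using rmax_less_half m by auto
  note props = attractor_props[OF rmax_nonneg r contr]
  show "attractor m (cplifs l b \<tau> \<rho>) = (\<Union>k\<in>{1..m}. cplifs l b \<tau> \<rho> k ` attractor m (cplifs l b \<tau> \<rho>))"
    by (rule props(1))
  show "\<bar>x\<bar> \<le> 2 * R" if \<tau>: "\<And>k. k \<in> {1..m} \<Longrightarrow> \<bar>\<tau> k\<bar> \<le> R" and x: "x \<in> attractor m (cplifs l b \<tau> \<rho>)"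
  proof -
    have "\<bar>x\<bar> \<le> R / (1 - rmax)" by (rule props(2)) (use \<tau> x cplifs_0[OF assms] in auto)
    also have "\<dots> \<le> R / (1 / 2)"
      using rmax_less_half \<tau>[of 1] m by (intro divide_left_mono) auto
    finally show ?thesis by simp
  qed
qed

text \<open>Fix all coordinates except \<open>\<tau> k\<close>, with \<open>k\<close> the first
  letter of \<open>w\<close>, up to a grid cell of side \<open>u\<close>. Over one cell the coded
  points are the values of \<open>b j\<close>, which differ by at most \<open>u\<close>, so
  transversality confines \<open>\<tau> k\<close> to a range of length \<open>T\<close>. If the
  \<open>u\<close>-cells of \<open>\<tau> k\<close> agreed as well, two distinct parameters would
  violate the separation; so at most \<open>T / u + 2\<close> of them share a cell.\<close>

lemma card_word_piece:
  assumes S: "finite S" and u: "0 < u" "u \<le> 1" and R: "0 \<le> R"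
    and break: "\<And>b \<tau>. (b, \<tau>) \<in> S \<Longrightarrow> b \<in> break_vectors m l"
    and bound: "\<And>b \<tau> i. (b, \<tau>) \<in> S \<Longrightarrow> i \<in> break_idx m l \<Longrightarrow> \<bar>b i\<bar> \<le> R"
      "\<And>b \<tau> i. (b, \<tau>) \<in> S \<Longrightarrow> i \<in> {1..m} \<Longrightarrow> \<bar>\<tau> i\<bar> \<le> R"
    and sep: "\<And>p p'. p \<in> S \<Longrightarrow> p' \<in> S \<Longrightarrow> p \<noteq> p' \<Longrightarrow> real (L + m) * u < param_dist m l p p'"
    and j: "j \<in> break_idx m l" and w: "set w \<subseteq> {1..m}" "w \<noteq> []"
    and code: "\<And>b \<tau>. (b, \<tau>) \<in> S \<Longrightarrow> \<exists>x. \<bar>x\<bar> \<le> 2 * R \<and> b j = foldr (cplifs l b \<tau> \<rho>) w x"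
  shows "real (card S) \<le> ((2 * R + 3) / u) ^ (L + m - 1) *
    ((2 * (4 * real L + 1) + prod_list (map slope w) * (4 * R) / u) / (1 - 2 * rmax) + 2)"
proof -
  obtain k v where kv: "w = k # v" using w by (cases w) auto
  have k: "k \<in> {1..m}" using w kv by simp
  \<comment> \<open>Dominates both the displacement \<open>u\<close> of a coordinate and the
    displacement \<open>4 * L * u\<close> of the maps caused by moving the breaking points.\<close>
  define e where "e = (4 * real L + 1) * u"
  have eu: "u \<le> e" "4 * real L * u \<le> e" "0 \<le> e" using u by (auto simp: e_def algebra_simps)
  \<comment> \<open>The transversality bound with \<open>D = 4 * R\<close>, as the starting points
    of both codings lie in \<open>[-2 * R, 2 * R]\<close>.\<close>
  define T where "T = (2 * e + prod_list (map slope w) * (4 * R)) / (1 - 2 * rmax)"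
  have w0: "0 \<le> prod_list (map slope w)" by (intro prod_list_nonneg) (auto simp: slope_nonneg)
  have T: "0 \<le> T" using rmax_less_half w0 eu R unfolding T_def by simp
  define cell where "cell p = (\<lambda>i\<in>break_idx m l. \<lfloor>fst p i / u\<rfloor>, \<lambda>i\<in>{1..m} - {k}. \<lfloor>snd p i / u\<rfloor>)"
    for p :: "(nat \<times> nat \<Rightarrow> real) \<times> (nat \<Rightarrow> real)"
  have close: "\<And>i. i \<in> break_idx m l \<Longrightarrow> \<bar>fst p i - fst q i\<bar> \<le> u"
    "\<And>i. i \<in> {1..m} - {k} \<Longrightarrow> \<bar>snd p i - snd q i\<bar> \<le> u" if "cell p = cell q" for p q
  proof -
    have eq: "(\<lambda>i\<in>break_idx m l. \<lfloor>fst p i / u\<rfloor>) = (\<lambda>i\<in>break_idx m l. \<lfloor>fst q i / u\<rfloor>)"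
      "(\<lambda>i\<in>{1..m} - {k}. \<lfloor>snd p i / u\<rfloor>) = (\<lambda>i\<in>{1..m} - {k}. \<lfloor>snd q i / u\<rfloor>)"
      using that by (auto simp: cell_def)
    show "\<bar>fst p i - fst q i\<bar> \<le> u" if "i \<in> break_idx m l" for i
      using fun_cong[OF eq(1), of i] that by (intro floor_cell_dist[OF u(1)]) simp
    show "\<bar>snd p i - snd q i\<bar> \<le> u" if "i \<in> {1..m} - {k}" for i
      using fun_cong[OF eq(2), of i] that by (intro floor_cell_dist[OF u(1)]) simp
  qed
  have fibre: "real (card {q \<in> S. cell q = cell p}) \<le> T / u + 2" if "p \<in> S" for p
  proof (rule card_le_of_floor_inj[where f = "\<lambda>q. snd q k"])
    show "inj_on (\<lambda>q. \<lfloor>snd q k / u\<rfloor>) {q \<in> S. cell q = cell p}"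
    proof (rule inj_onI, rule ccontr)
      fix q q'
      assume q: "q \<in> {q \<in> S. cell q = cell p}" and q': "q' \<in> {q \<in> S. cell q = cell p}"
        and eq: "\<lfloor>snd q k / u\<rfloor> = \<lfloor>snd q' k / u\<rfloor>" and "q \<noteq> q'"
      then have cl: "cell q = cell q'" by simp
      have "\<bar>snd q i - snd q' i\<bar> \<le> u" if "i \<in> {1..m}" for i
        using close(2)[OF cl, of i] floor_cell_dist[OF u(1) eq] that by (cases "i = k") auto
      then have "(\<Sum>i=1..m. \<bar>snd q i - snd q' i\<bar>) \<le> real (card {1..m}) * u"
        by (intro sum_bounded_above) auto
      moreover have "(\<Sum>i\<in>break_idx m l. \<bar>fst q i - fst q' i\<bar>) \<le> real L * u"
        by (intro sum_bounded_above close(1)[OF cl])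
      ultimately have "param_dist m l q q' \<le> real (L + m) * u"
        using param_dist_le_sum[of m l "fst q" "snd q" "fst q'" "snd q'"]
        by (simp add: algebra_simps)
      then show False using sep[of q q'] q q' \<open>q \<noteq> q'\<close> by auto
    qed
    show "\<bar>snd q k - snd q' k\<bar> \<le> T"
      if q: "q \<in> {q \<in> S. cell q = cell p}" and q': "q' \<in> {q \<in> S. cell q = cell p}" for q q'
    proof -
      obtain b \<tau> b' \<tau>' where bt: "q = (b, \<tau>)" "q' = (b', \<tau>')" by (cases q, cases q')
      have qS: "(b, \<tau>) \<in> S" "(b', \<tau>') \<in> S" and cl: "cell q = cell q'" using q q' bt by auto
      obtain x x' where x: "\<bar>x\<bar> \<le> 2 * R" "b j = foldr (cplifs l b \<tau> \<rho>) w x"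
        "\<bar>x'\<bar> \<le> 2 * R" "b' j = foldr (cplifs l b' \<tau>' \<rho>) w x'"
        using code[OF qS(1)] code[OF qS(2)] by blast
      note cb = close(1)[OF cl, unfolded bt fst_conv] and ct = close(2)[OF cl, unfolded bt snd_conv]
      have "\<bar>\<tau> k - \<tau>' k\<bar> \<le> (2 * e + prod_list (map slope (k # v)) * (4 * R)) / (1 - 2 * rmax)"
      proof (rule translation_transversality[where F = "cplifs l b \<tau> \<rho>" and F' = "cplifs l b' \<tau>' \<rho>"
            and K = "{1..m}" and x = x and x' = x', OF rmax_less_half])
        show "0 \<le> slope i \<and> slope i \<le> rmax" if "i \<in> {1..m}" for i
          using that slope_nonneg slope_le_rmax by blast
        show "\<bar>cplifs l b' \<tau>' \<rho> i x - cplifs l b' \<tau>' \<rho> i y\<bar> \<le> slope i * \<bar>x - y\<bar>"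
          if "i \<in> {1..m}" for i x y
          by (rule cplifs_lipschitz[OF break[OF qS(2)] that])
        show "\<bar>(cplifs l b \<tau> \<rho> i x - \<tau> i) - (cplifs l b' \<tau>' \<rho> i x - \<tau>' i)\<bar> \<le> e"
          if "i \<in> {1..m}" for i x
          using cplifs_perturbation[OF break[OF qS(1)] break[OF qS(2)] that cb less_imp_le[OF u(1)]] eu(2)
          by (rule order_trans)
        show "\<bar>\<tau> i - \<tau>' i\<bar> \<le> e" if "i \<in> {1..m} - {k}" for i using ct[OF that] eu(1) by simp
        show "set (k # v) \<subseteq> {1..m}" using w kv by simp
        show "\<bar>foldr (cplifs l b \<tau> \<rho>) (k # v) x - foldr (cplifs l b' \<tau>' \<rho>) (k # v) x'\<bar> \<le> e"
          using cb[OF j] eu(1) x(2,4) unfolding kv by linarith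
        show "\<bar>x - x'\<bar> \<le> 4 * R" using x(1,3) by linarith
      qed
      then show ?thesis by (simp add: T_def kv bt)
    qed
  qed (use S u T in auto)
  have "real (card S) \<le> real (card (cell ` S)) * (T / u + 2)"
    by (rule card_le_card_image_times_fibre[OF S fibre])
  also have "\<dots> \<le> ((2 * R + 3) / u) ^ (L + card ({1..m} - {k})) * (T / u + 2)"
    unfolding cell_def
    by (intro mult_right_mono card_grid_cells u R) (use bound u T in \<open>auto simp: finite_break_idx\<close>)
  also have "L + card ({1..m} - {k}) = L + m - 1" using k by simp
  also have "T / u = (2 * (4 * real L + 1) + prod_list (map slope w) * (4 * R) / u) / (1 - 2 * rmax)"
    using u(1) by (simp add: T_def e_def add_divide_distrib)
  finally show ?thesis .
qed

text \<open>The bound \<open>R\<close> makes the grid finite and confines the attractor; integer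
  values of \<open>R\<close> exhaust all non-regular parameters.\<close>

definition exceptional :: "real \<Rightarrow> ((nat \<times> nat \<Rightarrow> real) \<times> (nat \<Rightarrow> real)) set" where
  "exceptional R = {(b, \<tau>) \<in> break_vectors m l \<times> translation_vectors m.
     \<not> regular_cplifs m l b \<tau> \<rho> \<and> (\<forall>i\<in>break_idx m l. \<bar>b i\<bar> \<le> R) \<and> (\<forall>k\<in>{1..m}. \<bar>\<tau> k\<bar> \<le> R)}"

lemma card_separated_exceptional:
  assumes R: "0 \<le> R" and u: "0 < u" "u \<le> 1" and n: "0 < n"
    and S: "finite S" "S \<subseteq> exceptional R"
    and sep: "\<And>p p'. p \<in> S \<Longrightarrow> p' \<in> S \<Longrightarrow> p \<noteq> p' \<Longrightarrow> real (L + m) * u < param_dist m l p p'"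
  shows "real (card S) \<le> real L * ((2 * R + 3) / u) ^ (L + m - 1) *
    ((2 * (4 * real L + 1) / (1 - 2 * rmax) + 2) * real m ^ n
      + 4 * R / (1 - 2 * rmax) * (\<Sum>k=1..m. slope k) ^ n / u)"
proof -
  define W where "W = {w. set w \<subseteq> {1..m} \<and> length w = n}"
  have W: "finite W" unfolding W_def by (intro finite_lists_length_eq) simp
  \<comment> \<open>The attractor enters the pieces through the bound on \<open>x\<close> alone. The
    pieces may overlap, which a union bound tolerates; \<open>0 < n\<close> gives every word a first
    letter.\<close>
  define P where "P j w = {p \<in> S. \<exists>x. \<bar>x\<bar> \<le> 2 * R \<and> fst p j = foldr (cplifs l (fst p) (snd p) \<rho>) w x}"
    for j w
  have ex: "b \<in> break_vectors m l" "\<not> regular_cplifs m l b \<tau> \<rho>"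
    "\<And>i. i \<in> break_idx m l \<Longrightarrow> \<bar>b i\<bar> \<le> R" "\<And>k. k \<in> {1..m} \<Longrightarrow> \<bar>\<tau> k\<bar> \<le> R"
    if "(b, \<tau>) \<in> S" for b \<tau>
    using S that by (auto simp: exceptional_def)
  define G where "G = ((2 * R + 3) / u) ^ (L + m - 1)"
  define B where "B w = (2 * (4 * real L + 1) + prod_list (map slope w) * (4 * R) / u) / (1 - 2 * rmax) + 2"
    for w
  have "S \<subseteq> (\<Union>j\<in>break_idx m l. \<Union>w\<in>W. P j w)"
  proof clarify
    fix b \<tau> assume p: "(b, \<tau>) \<in> S"
    obtain j where j: "j \<in> break_idx m l" "b j \<in> attractor m (cplifs l b \<tau> \<rho>)"
      using ex(2)[OF p] unfolding regular_cplifs_def by auto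
    obtain w x where w: "length w = n" "set w \<subseteq> {1..m}" and x: "x \<in> attractor m (cplifs l b \<tau> \<rho>)"
      and bj: "b j = foldr (cplifs l b \<tau> \<rho>) w x"
      using invariant_set_coding[OF equalityD1[OF attractor_invariant(1)[OF ex(1)[OF p]]] j(2)] by blast
    have "\<bar>x\<bar> \<le> 2 * R" by (rule attractor_invariant(2)[OF ex(1)[OF p] _ x]) (rule ex(4)[OF p])
    then have "w \<in> W" "(b, \<tau>) \<in> P j w" using p w bj by (auto simp: W_def P_def)
    then show "(b, \<tau>) \<in> (\<Union>j\<in>break_idx m l. \<Union>w\<in>W. P j w)" using j by blast
  qed
  moreover have "finite (P j w)" for j w using S by (simp add: P_def)
  ultimately have "card S \<le> card (\<Union>j\<in>break_idx m l. \<Union>w\<in>W. P j w)"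
    using W by (intro card_mono) (auto simp: finite_break_idx)
  also have "\<dots> \<le> (\<Sum>j\<in>break_idx m l. card (\<Union>w\<in>W. P j w))"
    by (intro card_UN_le finite_break_idx)
  also have "\<dots> \<le> (\<Sum>j\<in>break_idx m l. \<Sum>w\<in>W. card (P j w))"
    by (intro sum_mono card_UN_le W)
  finally have "real (card S) \<le> (\<Sum>j\<in>break_idx m l. \<Sum>w\<in>W. real (card (P j w)))"
    by (metis (mono_tags, lifting) of_nat_le_iff of_nat_sum sum.cong)
  also have "\<dots> \<le> (\<Sum>j\<in>break_idx m l. \<Sum>w\<in>W. G * B w)"
  proof (intro sum_mono)
    fix j w assume j: "j \<in> break_idx m l" and w: "w \<in> W"
    have P: "P j w \<subseteq> S" by (auto simp: P_def)
    show "real (card (P j w)) \<le> G * B w"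
      unfolding G_def B_def
    proof (rule card_word_piece[OF _ u R _ _ _ _ j])
      show "finite (P j w)" using P S(1) by (rule finite_subset)
      show "set w \<subseteq> {1..m}" "w \<noteq> []" using w n by (auto simp: W_def)
      show "b \<in> break_vectors m l" if "(b, \<tau>) \<in> P j w" for b \<tau>
        using that by (intro ex(1)[OF subsetD[OF P]])
      show "\<bar>b i\<bar> \<le> R" if "(b, \<tau>) \<in> P j w" "i \<in> break_idx m l" for b \<tau> i
        using that by (intro ex(3)[OF subsetD[OF P]])
      show "\<bar>\<tau> i\<bar> \<le> R" if "(b, \<tau>) \<in> P j w" "i \<in> {1..m}" for b \<tau> i
        using that by (intro ex(4)[OF subsetD[OF P]])
      show "real (L + m) * u < param_dist m l p p'" if "p \<in> P j w" "p' \<in> P j w" "p \<noteq> p'" for p p'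
        using that by (intro sep subsetD[OF P])
      show "\<exists>x. \<bar>x\<bar> \<le> 2 * R \<and> b j = foldr (cplifs l b \<tau> \<rho>) w x" if "(b, \<tau>) \<in> P j w" for b \<tau>
        using that by (simp add: P_def)
    qed
  qed
  also have "\<dots> = real L * G * (\<Sum>w\<in>W. B w)" by (simp add: mult.assoc flip: sum_distrib_left)
  also have "(\<Sum>w\<in>W. B w) = (\<Sum>w\<in>W. (2 * (4 * real L + 1) / (1 - 2 * rmax) + 2)
      + 4 * R / (1 - 2 * rmax) / u * prod_list (map slope w))"
    by (intro sum.cong refl) (simp add: B_def add_divide_distrib mult_ac)
  also have "\<dots> = real m ^ n * (2 * (4 * real L + 1) / (1 - 2 * rmax) + 2)
      + 4 * R / (1 - 2 * rmax) / u * (\<Sum>k=1..m. slope k) ^ n"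
  proof -
    have "real (card W) = real m ^ n" by (simp add: W_def card_lists_length_eq)
    moreover have "(\<Sum>w\<in>W. prod_list (map slope w)) = (\<Sum>k=1..m. slope k) ^ n"
      unfolding W_def by (rule sum_prod_list_words)
    ultimately show ?thesis
      by (simp only: sum.distrib sum_constant distrib_left flip: sum_distrib_left)
  qed
  finally show ?thesis by (simp add: G_def mult.commute)
qed

text \<open>Words of length \<open>q\<close> are matched with the mesh
  \<open>u = 1 / (N * a ^ Suc q)\<close>. Because \<open>a\<close> is the square of
  \<open>m\<close>, the number of words \<open>m ^ q\<close> equals
  \<open>(1 / m) ^ q * a ^ q\<close>, a gain of rate \<open>1 / m\<close> over \<open>a ^ q\<close>;
  the thickness term decays with the sum of the slopes. \<open>\<theta>\<close> is the worse of the
  two rates.\<close>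

lemma card_separated_exceptional_scale:
  fixes a :: real
  assumes R: "0 \<le> R" and a: "a = (real m)\<^sup>2"
  defines "\<theta> \<equiv> max (1 / real m) (\<Sum>k=1..m. slope k)"
  shows "\<exists>C\<ge>0. \<forall>q\<ge>1. \<forall>S. finite S \<longrightarrow> S \<subseteq> exceptional R \<longrightarrow>
    (\<forall>x\<in>S. \<forall>y\<in>S. x \<noteq> y \<longrightarrow> 1 / a ^ Suc q < param_dist m l x y) \<longrightarrow>
    real (card S) \<le> C * (a powr real (L + m) * \<theta>) ^ q"
proof -
  define c1 c2 where "c1 = 2 * (4 * real L + 1) / (1 - 2 * rmax) + 2" and "c2 = 4 * R / (1 - 2 * rmax)"
  define N where "N = L + m"
  define C where "C = real L * (2 * R + 3) ^ (N - 1) * (real N * a) ^ N * (c1 + c2)"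
  have c: "0 \<le> c1" "0 \<le> c2" using rmax_less_half R by (auto simp: c1_def c2_def)
  have N: "1 \<le> real N" "N \<noteq> 0" using m by (auto simp: N_def)
  have a1: "1 \<le> a" using m by (simp add: a one_le_power)
  have \<theta>: "0 \<le> \<theta>" "1 / real m \<le> \<theta>" "(\<Sum>k=1..m. slope k) \<le> \<theta>" by (auto simp: \<theta>_def le_max_iff_disj)
  have "0 \<le> C" using c R a1 by (simp add: C_def)
  moreover have "real (card S) \<le> C * (a powr real N * \<theta>) ^ q"
    if q: "1 \<le> q" and S: "finite S" "S \<subseteq> exceptional R"
      and sep: "\<forall>x\<in>S. \<forall>y\<in>S. x \<noteq> y \<longrightarrow> 1 / a ^ Suc q < param_dist m l x y" for q S
  proof -
    \<comment> \<open>\<open>1 / v\<close> is the mesh. The factor \<open>N\<close> makes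
      \<open>(L + m) / v\<close> equal to the given separation \<open>1 / a ^ Suc q\<close>.\<close>
    define v where "v = real N * a ^ Suc q"
    have aq: "1 \<le> a ^ Suc q" using a1 by (rule one_le_power)
    have v: "1 \<le> v" unfolding v_def using mult_mono[OF N(1) aq] N aq by simp
    have "real (card S) \<le> real L * ((2 * R + 3) / (1 / v)) ^ (N - 1) *
        (c1 * real m ^ q + c2 * (\<Sum>k=1..m. slope k) ^ q / (1 / v))"
      unfolding c1_def c2_def N_def
    proof (rule card_separated_exceptional[OF R _ _ _ S])
      show "real (L + m) * (1 / v) < param_dist m l p p'" if "p \<in> S" "p' \<in> S" "p \<noteq> p'" for p p'
        using sep that N aq by (simp add: v_def N_def)
    qed (use v q in auto)
    also have "\<dots> = real L * (2 * R + 3) ^ (N - 1) * (v ^ (N - 1) *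
        (c1 * real m ^ q + c2 * (\<Sum>k=1..m. slope k) ^ q * v))"
      by (simp add: power_mult_distrib mult_ac)
    \<comment> \<open>A factor \<open>v\<close> is pulled out to complete \<open>v ^ (N - 1)\<close>
      to \<open>v ^ N\<close>; the rest decays like \<open>\<theta> ^ q\<close>.\<close>
    also have "\<dots> \<le> real L * (2 * R + 3) ^ (N - 1) * (v ^ (N - 1) * (v * ((c1 + c2) * \<theta> ^ q)))"
    proof (intro mult_left_mono)
      have "real m ^ q = (1 / real m) ^ q * a ^ q"
        using m by (simp add: a power2_eq_square flip: power_mult_distrib)
      also have "\<dots> \<le> \<theta> ^ q * v"
      proof (intro mult_mono power_mono \<theta>)
        have "a ^ q \<le> a ^ Suc q" using a1 by (intro power_increasing) auto
        also have "\<dots> \<le> v" unfolding v_def using N(1) aq by (simp add: mult_le_cancel_right1)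
        finally show "a ^ q \<le> v" .
      qed (use \<theta> a1 in auto)
      finally have "c1 * real m ^ q \<le> c1 * (\<theta> ^ q * v)" using c by (intro mult_left_mono)
      moreover have "c2 * (\<Sum>k=1..m. slope k) ^ q * v \<le> c2 * \<theta> ^ q * v"
        using c \<theta> v by (intro mult_right_mono mult_left_mono power_mono) (auto intro: sum_nonneg slope_nonneg)
      ultimately show "c1 * real m ^ q + c2 * (\<Sum>k=1..m. slope k) ^ q * v \<le> v * ((c1 + c2) * \<theta> ^ q)"
        by (simp add: algebra_simps)
    qed (use v R in auto)
    also have "\<dots> = real L * (2 * R + 3) ^ (N - 1) * (c1 + c2) * \<theta> ^ q * v ^ N"
      using N by (simp add: power_eq_if mult_ac)
    \<comment> \<open>The constant \<open>(N * a) ^ N\<close> takes up the \<open>Suc\<close> in the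
      exponent and goes into \<open>C\<close>.\<close>
    also have "v ^ N = (real N * a) ^ N * (a ^ N) ^ q"
      by (simp add: v_def power_mult_distrib power_mult flip: power_mult) (simp add: mult.commute)
    also have "a ^ N = a powr real N" using a1 by (simp add: powr_realpow)
    finally show ?thesis by (simp add: C_def power_mult_distrib mult_ac)
  qed
  ultimately show ?thesis unfolding N_def by blast
qed

end

theorem proposition2p3:
  fixes m :: nat and l :: "nat \<Rightarrow> nat" and \<rho> :: "nat \<times> nat \<Rightarrow> real"
  assumes "2 \<le> m"
    and "\<rho> \<in> small_slope_vectors m l"
  shows "packing_dim (param_space m l) (param_dist m l) 
           {(b, \<tau>) \<in> break_vectors m l \<times> translation_vectors m. \<not> regular_cplifs m l b \<tau> \<rho>}
           < ereal (real ((\<Sum>k=1..m. l k) + m))"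
proof -
  interpret small_slopes m l \<rho> by (rule small_slopes.intro) (rule assms)+
  define a where "a = (real m)\<^sup>2"
  have a: "1 < a" using m by (simp add: a_def one_less_power)
  show ?thesis
    unfolding card_break_idx[symmetric]
  proof (rule Metric_space.packing_dim_less_of_counting[OF Metric_space_param a,
        where \<theta> = "max (1 / real m) (\<Sum>k=1..m. slope k)" and A = "\<lambda>n. exceptional (real n)"])
    show "0 < max (1 / real m) (\<Sum>k=1..m. slope k)" "max (1 / real m) (\<Sum>k=1..m. slope k) < 1"
      "0 < real (L + m)"
      using m sum_slope_less_1 by (auto simp: less_max_iff_disj)
    show "exceptional (real n) \<subseteq> param_space m l" for n
      by (auto simp: exceptional_def param_space_def break_vectors_def translation_vectors_def)
    show "{(b, \<tau>) \<in> break_vectors m l \<times> translation_vectors m. \<not> regular_cplifs m l b \<tau> \<rho>}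
        \<subseteq> (\<Union>n. exceptional (real n))"
    proof clarify
      fix b \<tau> assume *: "b \<in> break_vectors m l" "\<tau> \<in> translation_vectors m" "\<not> regular_cplifs m l b \<tau> \<rho>"
      \<comment> \<open>One bound on the sum of all absolute values controls every
        coordinate.\<close>
      obtain n where n: "(\<Sum>i\<in>break_idx m l. \<bar>b i\<bar>) + (\<Sum>k=1..m. \<bar>\<tau> k\<bar>) \<le> real n"
        using real_arch_simple by blast
      have nonneg: "0 \<le> (\<Sum>i\<in>break_idx m l. \<bar>b i\<bar>)" "0 \<le> (\<Sum>k=1..m. \<bar>\<tau> k\<bar>)"
        by (auto intro: sum_nonneg)
      have "\<bar>b i\<bar> \<le> real n" if "i \<in> break_idx m l" for i
      proof -
        have "\<bar>b i\<bar> \<le> (\<Sum>i\<in>break_idx m l. \<bar>b i\<bar>)"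
          using that finite_break_idx by (intro member_le_sum) auto
        then show ?thesis using n nonneg by linarith
      qed
      moreover have "\<bar>\<tau> k\<bar> \<le> real n" if "k \<in> {1..m}" for k
      proof -
        have "\<bar>\<tau> k\<bar> \<le> (\<Sum>k=1..m. \<bar>\<tau> k\<bar>)" using that by (intro member_le_sum) auto
        then show ?thesis using n nonneg by linarith
      qed
      ultimately have "(b, \<tau>) \<in> exceptional (real n)" using * by (simp add: exceptional_def)
      then show "(b, \<tau>) \<in> (\<Union>n. exceptional (real n))" by blast
    qed
    \<comment> \<open>The threshold is \<open>q0 = 1\<close>, since \<open>q\<close> is the length
      of the words and these must be nonempty.\<close>
    show "\<exists>C\<ge>0. \<exists>q0. \<forall>q\<ge>q0. \<forall>S. finite S \<longrightarrow> S \<subseteq> exceptional (real n) \<longrightarrow>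
        (\<forall>x\<in>S. \<forall>y\<in>S. x \<noteq> y \<longrightarrow> 1 / a ^ Suc q < param_dist m l x y) \<longrightarrow>
        real (card S) \<le> C * (a powr real (L + m) * max (1 / real m) (\<Sum>k=1..m. slope k)) ^ q" for n
      using card_separated_exceptional_scale[OF of_nat_0_le_iff a_def]
      by (rule ex_forward) (erule conj_forward, assumption, rule exI[of _ 1])
  qed
qed

end
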